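(* Let $\Omega$ be a domain in $\mathbf{R}^2$ and let $A=(A_{ij})_{1\le i,j\le 2}$, where the $A_{ij}=A_{ij}(x_1,x_2)\in W^{1,\infty}(\Omega)$ are real valued functions on $\Omega$ satisfying, for constants $C_1,C_2>0$, $$\sup_{(x_1,x_2)\in\Omega}|A_{ij}(x_1,x_2)|\le C_1,\qquad \sup_{(x_1,x_2)\in\Omega}|\nabla A_{ij}(x_1,x_2)|\le C_1,\qquad 1\le i,j\le 2,$$ $$|\det A|^{-1}=|A_{11}A_{22}-A_{12}A_{21}|^{-1}\le C_2,$$ $$A_{11}\ne 0,\quad A_{22}\neq 0 .$$ Let $b_{ij}=b_{ij}(x_1,x_2)\in W^{1,\infty}(\Omega)$ $(1\le i,j\le 2)$ be real valued functions on $\Omega$ satisfying, for a constant $C_3>0$, $$\sup_{(x_1,x_2)\in\Omega}|b_{ij}(x_1,x_2)|\le C_3,\qquad \sup_{(x_1,x_2)\in\Omega}|\nabla b_{ij}(x_1,x_2)|\le C_3,\qquad 1\le i,j\le 2.$$ Suppose that a real valued function $u\in C^2(\Omega)$ satisfies, for constants $C_4,C_5>0$, $$-\sum_{j=1}^{2}\Big\{\frac{\partial}{\partial x_i}\Big(A_{ij}\frac{\partial u}{\partial x_j}\Big)+b_{ij}\frac{\partial u}{\partial x_j}\Big\}(x_1,x_2)\le C_4\quad\text{in }\Omega,\quad i=1,2,$$ $$\sup_{(x_1,x_2)\in\Omega}|u|\le C_5 .$$ Then for any $(y_1,y_2)\in\Omega$ and any $\delta>0$ such that $$K'=[y_1-2\delta,y_1+2\delta]\times[y_2-2\delta,y_2+2\delta]\subset\Omega,$$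 setting $K=[y_1-\delta,y_1+\delta]\times[y_2-\delta,y_2+\delta]$, there exists a constant $\overline{C}>0$, depending on $\delta$, the matrices $(A_{ij})$, $(b_{ij})$, and the constants $C_4,C_5$, such that $$\sup_{(x_1,x_2)\in K}|\nabla u|\le\overline{C},\qquad \overline{C}=O\Big(\frac1\delta\Big).$$
   Context: The conditions on $\det A$, $A_{11}$, $A_{22}$ are imposed at the points of $\Omega$. There is no summation over the repeated index $i$ in the differential inequalities: there is one inequality for each $i$.
   Formalization: The constant also depends on y, through the minimum m of |A11| and |A22| over K': it is O(1/δ) as δ→0 for each fixed m and decreasing in m; a constant independent of y with O(1/δ) fails when A11, A22 tend to 0 at the boundary of Ω. *)

theory Defs
  imports "HOL-Analysis.Analysis" "HOL-Library.Landau_Symbols"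
begin

definition partial :: "2 \<Rightarrow> (real^2 \<Rightarrow> real) \<Rightarrow> real^2 \<Rightarrow> real" where
  "partial k f x = frechet_derivative f (at x) (axis k 1)"

definition grad :: "(real^2 \<Rightarrow> real) \<Rightarrow> real^2 \<Rightarrow> real^2" where
  "grad f x = (\<chi> k. partial k f x)"

text \<open>Differentiability on the open set \<open>S\<close> is demanded explicitly, because
  \<^const>\<open>frechet_derivative\<close> is a meaningless choice where there is no derivative.\<close>

definition C1_on :: "(real^2) set \<Rightarrow> (real^2 \<Rightarrow> real) \<Rightarrow> bool" where
  "C1_on S f \<longleftrightarrow> (\<forall>x\<in>S. f differentiable (at x)) \<and> (\<forall>k. continuous_on S (partial k f))"

definition C2_on :: "(real^2) set \<Rightarrow> (real^2 \<Rightarrow> real) \<Rightarrow> bool" where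
  "C2_on S f \<longleftrightarrow> C1_on S f \<and> (\<forall>k. C1_on S (partial k f))"

text \<open>Weak first order derivatives are tested against compactly supported functions of class
  \<open>C\<^sup>1\<close>, as in Gilbarg and Trudinger, Section 7.3.\<close>

definition test_fun :: "(real^2) set \<Rightarrow> (real^2 \<Rightarrow> real) \<Rightarrow> bool" where
  "test_fun S \<phi> \<longleftrightarrow>
     C1_on UNIV \<phi> \<and> (\<exists>K. compact K \<and> K \<subseteq> S \<and> (\<forall>x. x \<notin> K \<longrightarrow> \<phi> x = 0))"

definition loc_integrable :: "(real^2) set \<Rightarrow> (real^2 \<Rightarrow> real) \<Rightarrow> bool" where
  "loc_integrable S f \<longleftrightarrow> (\<forall>K. compact K \<and> K \<subseteq> S \<longrightarrow> integrable (lebesgue_on K) f)"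

definition has_weak_partial ::
    "(real^2) set \<Rightarrow> 2 \<Rightarrow> (real^2 \<Rightarrow> real) \<Rightarrow> (real^2 \<Rightarrow> real) \<Rightarrow> bool" where
  "has_weak_partial S k f g \<longleftrightarrow>
     loc_integrable S f \<and> loc_integrable S g \<and>
     (\<forall>\<phi>. test_fun S \<phi> \<longrightarrow>
        (LINT x|lebesgue_on S. f x * partial k \<phi> x) = - (LINT x|lebesgue_on S. g x * \<phi> x))"

definition has_weak_grad ::
    "(real^2) set \<Rightarrow> (real^2 \<Rightarrow> real) \<Rightarrow> (real^2 \<Rightarrow> real^2) \<Rightarrow> bool" where
  "has_weak_grad S f G \<longleftrightarrow> (\<forall>k. has_weak_partial S k f (\<lambda>x. G x $ k))"

text \<open>An element of \<open>W\<^sup>1\<^sup>,\<^sup>\<infinity>\<close> of an open set is an almost everywhere class with exactly one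
  continuous representative.  The function \<open>f\<close> below is that representative, so that conditions
  at the individual points of \<open>S\<close> make sense.\<close>

definition W1inf :: "(real^2) set \<Rightarrow> (real^2 \<Rightarrow> real) \<Rightarrow> bool" where
  "W1inf S f \<longleftrightarrow> continuous_on S f \<and> bounded (f ` S) \<and>
     (\<exists>G M. has_weak_grad S f G \<and> (AE x in lebesgue_on S. norm (G x) \<le> M))"

text \<open>The supremum of a weak gradient is an essential supremum.\<close>

definition weak_grad_le :: "(real^2) set \<Rightarrow> (real^2 \<Rightarrow> real) \<Rightarrow> real \<Rightarrow> bool" where
  "weak_grad_le S f C \<longleftrightarrow>
     (\<exists>G. has_weak_grad S f G \<and> (AE x in lebesgue_on S. norm (G x) \<le> C))"

text \<open>For each \<open>i\<close> separately,
  \<open>- (\<Sum>j. \<partial>\<^sub>i (A\<^sub>i\<^sub>j \<partial>\<^sub>j u) + b\<^sub>i\<^sub>j \<partial>\<^sub>j u) \<le> C\<close>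
  almost everywhere in \<open>S\<close>.  Here \<open>h i j\<close> is the weak derivative \<open>\<partial>\<^sub>i (A\<^sub>i\<^sub>j \<partial>\<^sub>j u)\<close>; it always
  exists for \<open>A\<^sub>i\<^sub>j\<close> in \<open>W\<^sup>1\<^sup>,\<^sup>\<infinity>\<close> and \<open>u\<close> of class \<open>C\<^sup>2\<close>, and is unique up to a null set.\<close>

definition diff_ineqs ::
    "(real^2) set \<Rightarrow> (real^2 \<Rightarrow> real^2^2) \<Rightarrow> (real^2 \<Rightarrow> real^2^2) \<Rightarrow> real \<Rightarrow> (real^2 \<Rightarrow> real) \<Rightarrow> bool"
  where
  "diff_ineqs S A b C u \<longleftrightarrow>
     (\<exists>h. (\<forall>i j. has_weak_partial S i (\<lambda>x. A x $ i $ j * partial j u x) (h i j)) \<and>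
          (\<forall>i. AE x in lebesgue_on S.
                 - (\<Sum>j\<in>UNIV. h i j x + b x $ i $ j * partial j u x) \<le> C))"

definition square :: "real^2 \<Rightarrow> real \<Rightarrow> (real^2) set" where
  "square y r = cbox (y - vec r) (y + vec r)"

text \<open>How far the diagonal entries of \<open>A\<close> stay away from zero on \<open>Q\<close>.\<close>

definition diag_inf :: "(real^2 \<Rightarrow> real^2^2) \<Rightarrow> (real^2) set \<Rightarrow> real" where
  "diag_inf A Q = (INF x\<in>Q. min \<bar>A x $ 1 $ 1\<bar> \<bar>A x $ 2 $ 2\<bar>)"

lemma diag_inf_pos:
  assumes "compact Q" "Q \<noteq> {}" "\<And>i j. continuous_on Q (\<lambda>x. A x $ i $ j)"
    and "\<And>x. x \<in> Q \<Longrightarrow> A x $ 1 $ 1 \<noteq> 0" "\<And>x. x \<in> Q \<Longrightarrow> A x $ 2 $ 2 \<noteq> 0"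
  shows "0 < diag_inf A Q"
proof -
  let ?f = "\<lambda>x. min \<bar>A x $ 1 $ 1\<bar> \<bar>A x $ 2 $ 2\<bar>"
  have "continuous_on Q ?f"
    by (intro continuous_intros assms)
  then obtain z where z: "z \<in> Q" "\<And>x. x \<in> Q \<Longrightarrow> ?f z \<le> ?f x"
    using continuous_attains_inf[OF assms(1,2)] by blast
  have "0 < ?f z"
    using assms(4,5) z(1) by auto
  also have "?f z \<le> diag_inf A Q"
    unfolding diag_inf_def using assms(2) z(2) by (intro cINF_greatest) auto
  finally show ?thesis .
qed

end

theory Submission
  imports Defs
begin

text \<open>Write \<open>w\<^sub>i = \<Sum>j. A\<^sub>i\<^sub>j \<partial>\<^sub>j u\<close>.  As \<open>1 / \<bar>det A\<bar>\<close> is bounded, it suffices to bound the two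
fluxes \<open>w\<^sub>1\<close> and \<open>w\<^sub>2\<close>.  The first order terms of the \<open>i\<close>-th inequality only cost a multiple of
\<open>sup \<bar>\<nabla>u\<bar>\<close>, so it says that \<open>w\<^sub>i\<close> is almost nondecreasing along \<open>e\<^sub>i\<close>.  Hence \<open>w\<^sub>i(x\<^sub>0)\<close> lies, up
to a small error, between the mean of \<open>w\<^sub>i\<close> over the segment of length \<open>\<rho>\<close> that ends at \<open>x\<^sub>0\<close> and
the mean over the segment that starts there, both parallel to \<open>e\<^sub>i\<close>.

Such a mean is \<open>A\<^sub>i\<^sub>i\<close> times the mean of \<open>\<partial>\<^sub>i u\<close>, a difference quotient of the bounded function
\<open>u\<close>, plus \<open>A\<^sub>i\<^sub>j\<close> (\<open>j \<noteq> i\<close>) times the mean of \<open>\<partial>\<^sub>j u\<close> over a segment \<^emph>\<open>transverse\<close> to \<open>e\<^sub>j\<close>.  The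
other inequality controls the latter.  Divided by \<open>A\<^sub>j\<^sub>j\<close>, it says that \<open>\<partial>\<^sub>j u\<close> is almost monotone
along the direction \<open>v = q e\<^sub>i + e\<^sub>j\<close>, where \<open>q = A\<^sub>j\<^sub>i / A\<^sub>j\<^sub>j\<close>; since \<open>A\<^sub>j\<^sub>j \<noteq> 0\<close>, this direction is transverse to
\<open>e\<^sub>i\<close>.  Let \<open>V(s)\<close> be the integral of \<open>\<partial>\<^sub>j u\<close> over the segment translated by \<open>s v\<close>, and \<open>U(s)\<close>
that of \<open>u\<close>.  Up to values of \<open>u\<close> at the ends of the segment, \<open>V\<close> is the derivative of the
bounded function \<open>U\<close>; so \<open>V\<close> is bounded at some \<open>s > 0\<close> and at some \<open>s < 0\<close> by the mean value
theorem, and as \<open>V\<close> is almost monotone, \<open>V(0)\<close> is bounded.  This two-sided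
bound is \<open>transverse_line_integral_bound\<close>, the heart of the proof.

The coefficients have to be frozen at \<open>x\<^sub>0\<close> in both steps.  That produces integrals of a small
Lipschitz function times a second derivative of \<open>u\<close> in the direction of the segment, which
integration by parts (\<open>integral_Lipschitz_times_derivative\<close>) turns into \<open>O(\<rho> sup \<bar>\<nabla>u\<bar>)\<close>.  The
outcome (\<open>gradient_bound\<close>) is
\<open>\<bar>\<nabla>u(x\<^sub>0)\<bar> \<le> c / \<rho> + c \<rho> (C\<^sub>4 + sup \<bar>\<nabla>u\<bar>)\<close>, with the supremum over a square around \<open>x\<^sub>0\<close>.  It is
applied at the maximum point of \<open>\<bar>\<nabla>u\<bar>\<close> times the distance to the boundary of the large
square: there the supremum is at most \<open>2 \<bar>\<nabla>u(x\<^sub>0)\<bar>\<close>, and for small \<open>\<rho>\<close> it is absorbed by the left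
hand side (\<open>interior_gradient_estimate\<close>).

All this needs Lipschitz coefficients and the inequalities at every point.  Testing with
products of bumps supplies both: \<open>weak_grad_le_imp_Lipschitz_on_square\<close> for the coefficients, and
\<open>pointwise_differential_inequality\<close> for the nondivergence form of the inequalities.\<close>

section \<open>Partial derivatives along lines\<close>

lemma partial_eqI:
  assumes "(f has_derivative D) (at x)"
  shows "partial k f x = D (axis k 1)"
  using frechet_derivative_at[OF assms] by (simp add: partial_def)

lemma C1_on_has_derivative:
  assumes "C1_on S f" "x \<in> S"
  shows "(f has_derivative (\<lambda>h. \<Sum>k\<in>UNIV. partial k f x * h $ k)) (at x)"
proof -
  have d: "(f has_derivative frechet_derivative f (at x)) (at x)"
    using assms by (simp add: C1_on_def frechet_derivative_works)
  then have lin: "linear (frechet_derivative f (at x))"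
    by (rule has_derivative_linear)
  have "frechet_derivative f (at x) h = (\<Sum>k\<in>UNIV. partial k f x * h $ k)" for h
  proof -
    have "frechet_derivative f (at x) h = frechet_derivative f (at x) (\<Sum>k\<in>UNIV. h $ k *\<^sub>R axis k 1)"
    proof -
      have "h = (\<Sum>k\<in>UNIV. h $ k *\<^sub>R axis k 1)"
        by (simp add: vec_eq_iff axis_def sum_2 forall_2)
      then show ?thesis by simp
    qed
    also have "\<dots> = (\<Sum>k\<in>UNIV. partial k f x * h $ k)"
      by (simp add: linear_sum[OF lin] linear_scale[OF lin] partial_def mult.commute)
    finally show ?thesis .
  qed
  then have "frechet_derivative f (at x) = (\<lambda>h. \<Sum>k\<in>UNIV. partial k f x * h $ k)"
    by (rule ext)
  with d show ?thesis by simp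
qed

lemma C1_on_continuous_on: "C1_on S f \<Longrightarrow> continuous_on S f"
  by (intro continuous_at_imp_continuous_on ballI has_derivative_continuous[OF C1_on_has_derivative])

lemma C1_on_subset: "C1_on S f \<Longrightarrow> T \<subseteq> S \<Longrightarrow> C1_on T f"
  unfolding C1_on_def using continuous_on_subset by blast

lemma C1_on_DERIV_line:
  assumes "C1_on S f" "x + t *\<^sub>R v \<in> S"
  shows "((\<lambda>t. f (x + t *\<^sub>R v)) has_real_derivative
           (\<Sum>k\<in>UNIV. partial k f (x + t *\<^sub>R v) * v $ k)) (at t)"
proof -
  have "((\<lambda>t. x + t *\<^sub>R v) has_derivative (\<lambda>h. h *\<^sub>R v)) (at t)"
    by (auto intro!: derivative_eq_intros)
  from has_derivative_compose[OF this C1_on_has_derivative[OF assms]]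
  show ?thesis
    by (rule has_derivative_imp_has_field_derivative) (simp add: sum_distrib_left mult_ac)
qed

lemma sum_UNIV_2:
  fixes i j :: 2 assumes "i \<noteq> j"
  shows "(\<Sum>k\<in>UNIV. f k) = f i + f j"
  using exhaust_2[of i] exhaust_2[of j] assms by (auto simp: sum_2 add.commute)

lemma UNIV_eq_2:
  fixes i j :: 2 assumes "i \<noteq> j"
  shows "UNIV = {i, j}"
  using exhaust_2[of i] exhaust_2[of j] assms by (auto simp: UNIV_2)

lemma C1_on_DERIV_axis:
  assumes "C1_on S f" "x + t *\<^sub>R axis i 1 \<in> S"
  shows "((\<lambda>t. f (x + t *\<^sub>R axis i 1)) has_real_derivative
           partial i f (x + t *\<^sub>R axis i 1)) (at t)"
proof -
  have "(\<Sum>k\<in>UNIV. partial k f (x + t *\<^sub>R axis i 1) * axis i 1 $ k) = partial i f (x + t *\<^sub>R axis i 1)"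
    by (simp add: axis_def if_distrib[of "(*) _"] cong: if_cong)
  then show ?thesis
    using C1_on_DERIV_line[OF assms] by simp
qed

section \<open>Integrals of a Lipschitz function against a derivative\<close>

text \<open>Cut \<open>[a, b]\<close> into \<open>n\<close> equal pieces: the quadratic terms add up to \<open>O(1 / n)\<close>.\<close>

lemma increment_bound_linear:
  fixes F :: "real \<Rightarrow> real"
  assumes "a \<le> b"
    and inc: "\<And>s t. a \<le> s \<Longrightarrow> s \<le> t \<Longrightarrow> t \<le> b \<Longrightarrow> \<bar>F t - F s\<bar> \<le> c * (t - s) + d * (t - s)\<^sup>2"
  shows "\<bar>F b - F a\<bar> \<le> c * (b - a)"
proof -
  have *: "\<bar>F b - F a\<bar> \<le> c * (b - a) + d * (b - a)\<^sup>2 * inverse (real (Suc n))" for n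
  proof -
    define h where "h = (b - a) / real (Suc n)"
    define p where "p k = a + real k * h" for k
    have h0: "0 \<le> h" using assms(1) by (simp add: h_def)
    have hn: "real (Suc n) * h = b - a" by (simp add: h_def)
    have pSuc: "p (Suc k) = p k + h" for k by (simp add: p_def algebra_simps)
    have ends: "p 0 = a" "p (Suc n) = b" using hn by (simp_all add: p_def)
    have ple: "a \<le> p k" for k using h0 by (simp add: p_def)
    have pge: "p k \<le> b" if "k \<le> Suc n" for k
    proof -
      have "real k * h \<le> real (Suc n) * h" using h0 that by (intro mult_right_mono) simp_all
      then show ?thesis using hn by (simp add: p_def)
    qed
    have "F b - F a = (\<Sum>k<Suc n. F (p (Suc k)) - F (p k))"
      unfolding sum_lessThan_telescope[of "\<lambda>k. F (p k)"] ends ..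
    also have "\<bar>\<dots>\<bar> \<le> (\<Sum>k<Suc n. c * h + d * h\<^sup>2)"
    proof (rule order_trans[OF sum_abs sum_mono])
      fix k assume "k \<in> {..<Suc n}"
      then have k: "Suc k \<le> Suc n" by simp
      have "\<bar>F (p (Suc k)) - F (p k)\<bar> \<le> c * (p (Suc k) - p k) + d * (p (Suc k) - p k)\<^sup>2"
        using h0 by (intro inc ple pge[OF k]) (simp add: pSuc)
      then show "\<bar>F (p (Suc k)) - F (p k)\<bar> \<le> c * h + d * h\<^sup>2" by (simp add: pSuc)
    qed
    also have "\<dots> = c * (real (Suc n) * h) + d * (real (Suc n) * h)\<^sup>2 * inverse (real (Suc n))"
    proof -
      have "N * (c * h + d * h\<^sup>2) = c * (N * h) + d * (N * h)\<^sup>2 * inverse N" if "N > 0" for N :: real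
        using that by (simp add: field_simps power2_eq_square)
      from this[of "real (Suc n)"] show ?thesis by simp
    qed
    finally show ?thesis unfolding hn .
  qed
  have "(\<lambda>n. c * (b - a) + d * (b - a)\<^sup>2 * inverse (real (Suc n))) \<longlonglongrightarrow> c * (b - a) + d * (b - a)\<^sup>2 * 0"
    by (intro tendsto_intros LIMSEQ_inverse_real_of_nat)
  then show ?thesis
    using * by (intro LIMSEQ_le_const[where a = "\<bar>F b - F a\<bar>"]) auto
qed

text \<open>Integration by parts without a derivative of \<open>g\<close>.  Formally the left hand side is
\<open>g W\<close> at the ends minus \<open>\<integral> g' W\<close> with \<open>\<bar>g'\<bar> \<le> L\<close>.  The bound involves \<open>W\<close> but not \<open>W'\<close>, and this
is its purpose: below \<open>W\<close> is a first derivative of \<open>u\<close>, and \<open>W'\<close> a second derivative, for which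
there is no estimate.\<close>

lemma integral_Lipschitz_times_derivative:
  fixes g W W' :: "real \<Rightarrow> real"
  assumes ab: "a \<le> b"
    and lip: "\<And>s t. s \<in> {a..b} \<Longrightarrow> t \<in> {a..b} \<Longrightarrow> \<bar>g s - g t\<bar> \<le> L * \<bar>s - t\<bar>"
    and der: "\<And>t. t \<in> {a..b} \<Longrightarrow> (W has_real_derivative W' t) (at t)"
    and cont: "continuous_on {a..b} W'"
    and bd: "\<And>t. t \<in> {a..b} \<Longrightarrow> \<bar>W t\<bar> \<le> S"
  shows "\<bar>integral {a..b} (\<lambda>t. g t * W' t)\<bar> \<le> (\<bar>g a\<bar> + \<bar>g b\<bar> + L * (b - a)) * S"
proof -
  have contg: "continuous_on {a..b} g"
  proof (rule continuous_onI)
    fix x e :: real assume x: "x \<in> {a..b}" and e: "0 < e"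
    show "\<exists>d>0. \<forall>x'\<in>{a..b}. dist x' x < d \<longrightarrow> dist (g x') (g x) \<le> e"
    proof (intro exI[of _ "e / (\<bar>L\<bar> + 1)"] conjI ballI impI)
      show "0 < e / (\<bar>L\<bar> + 1)" using e by simp
      fix y assume y: "y \<in> {a..b}" and d: "dist y x < e / (\<bar>L\<bar> + 1)"
      have "\<bar>g y - g x\<bar> \<le> L * \<bar>y - x\<bar>" using lip x y by blast
      also have "\<dots> \<le> (\<bar>L\<bar> + 1) * \<bar>y - x\<bar>" by (intro mult_right_mono) auto
      also have "\<dots> \<le> e" using d by (simp add: dist_real_def field_simps)
      finally show "dist (g y) (g x) \<le> e" by (simp add: dist_real_def)
    qed
  qed
  note ci = continuous_on_mult[OF contg cont]
  obtain M where M: "\<And>t. t \<in> {a..b} \<Longrightarrow> \<bar>W' t\<bar> \<le> M"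
  proof -
    have "bounded (W' ` {a..b})"
      by (intro compact_imp_bounded compact_continuous_image cont compact_Icc)
    then show ?thesis using that by (metis bounded_iff image_eqI real_norm_def)
  qed
  \<comment> \<open>\<open>F\<close> plays the role of \<open>- \<integral> g' W\<close>; on a short interval \<open>g\<close> is nearly constant, so \<open>F\<close> changes
      by at most \<open>L S\<close> times the length, up to a quadratic error.\<close>
  define F where "F t = integral {a..t} (\<lambda>r. g r * W' r) - g t * W t" for t
  have inc: "\<bar>F t - F s\<bar> \<le> (L * S) * (t - s) + (L * M) * (t - s)\<^sup>2"
    if st: "a \<le> s" "s \<le> t" "t \<le> b" for s t
  proof -
    have sub: "{s..t} \<subseteq> {a..b}" using st by auto
    have L0: "L * (t - s) \<ge> 0" using lip[of s t] st by (smt (verit) atLeastAtMost_iff abs_ge_zero)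
    have int: "(\<lambda>r. g r * W' r) integrable_on {a..t}"
      by (intro integrable_continuous_real continuous_on_subset[OF ci]) (use st in auto)
    have split: "integral {a..t} (\<lambda>r. g r * W' r) = integral {a..s} (\<lambda>r. g r * W' r) + integral {s..t} (\<lambda>r. g r * W' r)"
      using Henstock_Kurzweil_Integration.integral_combine[OF st(1,2) int] by simp
    have WW: "(W' has_integral (W t - W s)) {s..t}"
      using sub st(2) by (intro fundamental_theorem_of_calculus)
        (auto intro!: has_field_derivative_at_within[OF der] simp flip: has_real_derivative_iff_has_vector_derivative)
    have int2: "((\<lambda>r. (g r - g t) * W' r) has_integral integral {s..t} (\<lambda>r. g r * W' r) - g t * (W t - W s)) {s..t}"
      unfolding left_diff_distrib
      by (intro has_integral_diff has_integral_mult_right WW integrable_integral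
          integrable_continuous_real continuous_on_subset[OF ci sub])
    have "\<bar>integral {s..t} (\<lambda>r. g r * W' r) - g t * (W t - W s)\<bar> \<le> (L * (t - s) * M) * (t - s)"
    proof -
      have "norm (integral {s..t} (\<lambda>r. g r * W' r) - g t * (W t - W s)) \<le> (L * (t - s) * M) * measure lborel (cbox s t)"
      proof (rule has_integral_bound[where f = "\<lambda>r. (g r - g t) * W' r"])
        show "0 \<le> L * (t - s) * M"
          using L0 M[of s] st by (smt (verit) atLeastAtMost_iff mult_nonneg_nonneg abs_ge_zero)
        show "((\<lambda>r. (g r - g t) * W' r) has_integral integral {s..t} (\<lambda>r. g r * W' r) - g t * (W t - W s)) (cbox s t)"
          using int2 by simp
        fix r assume r: "r \<in> cbox s t"
        then have r': "r \<in> {a..b}" "t \<in> {a..b}" "s \<in> {a..b}" "s \<le> r" "r \<le> t" using sub st by auto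
        have "\<bar>g r - g t\<bar> \<le> L * (t - r)" using lip[OF r'(1,2)] r'(5) by simp
        also have "\<dots> \<le> L * (t - s)"
        proof (cases "s = t")
          case True then show ?thesis using r' by simp
        next
          case False
          then have "0 \<le> L" using L0 st by (simp add: zero_le_mult_iff)
          then show ?thesis using r' by (intro mult_left_mono) auto
        qed
        finally show "norm ((g r - g t) * W' r) \<le> L * (t - s) * M"
          unfolding real_norm_def abs_mult by (intro mult_mono M r'(1) L0) simp_all
      qed
      then show ?thesis using st by simp
    qed
    moreover have "\<bar>(g t - g s) * W s\<bar> \<le> L * (t - s) * S"
      unfolding abs_mult using lip[of t s] bd[of s] st L0 by (intro mult_mono) auto
    moreover have "F t - F s = (integral {s..t} (\<lambda>r. g r * W' r) - g t * (W t - W s)) - (g t - g s) * W s"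
      unfolding F_def split by (simp add: algebra_simps)
    ultimately show ?thesis by (simp add: algebra_simps power2_eq_square)
  qed
  have "\<bar>F b - F a\<bar> \<le> (L * S) * (b - a)"
    by (rule increment_bound_linear[OF ab inc])
  moreover have "F b - F a = integral {a..b} (\<lambda>t. g t * W' t) - g b * W b + g a * W a"
    by (simp add: F_def)
  moreover have "\<bar>g b * W b\<bar> \<le> \<bar>g b\<bar> * S" "\<bar>g a * W a\<bar> \<le> \<bar>g a\<bar> * S"
    using bd[of a] bd[of b] ab by (auto simp: abs_mult intro!: mult_left_mono)
  ultimately show ?thesis by (simp add: algebra_simps)
qed

section \<open>Symmetry of second derivatives\<close>

text \<open>The increment of \<open>\<partial>\<^sub>i u\<close> along \<open>e\<^sub>j\<close> is the integral of \<open>\<partial>\<^sub>i \<partial>\<^sub>j u\<close>, because \<open>\<partial>\<^sub>i\<close> may be taken under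
the integral that recovers \<open>u\<close> from \<open>\<partial>\<^sub>j u\<close>; differentiate this identity at \<open>s = 0\<close>.\<close>

lemma C2_on_mixed_partials_commute:
  assumes S: "open S" and u: "C2_on S u" and x: "x \<in> S" and ij: "i \<noteq> j"
  shows "partial i (partial j u) x = partial j (partial i u) x"
proof -
  let ?p = "\<lambda>t s. x + t *\<^sub>R axis i 1 + s *\<^sub>R axis j (1::real)"
  obtain r where r: "r > 0" "ball x r \<subseteq> S" using S x openE by blast
  define \<eta> where "\<eta> = r / 3"
  have \<eta>: "\<eta> > 0" using r by (simp add: \<eta>_def)
  have inS: "?p t s \<in> S" if "t \<in> {-\<eta>..\<eta>}" "s \<in> {0..\<eta>}" for t s
  proof -
    have "norm (t *\<^sub>R axis i 1 + s *\<^sub>R axis j (1::real) :: real^2) \<le> \<bar>t\<bar> + \<bar>s\<bar>"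
      by (rule order_trans[OF norm_triangle_ineq]) simp
    also have "\<dots> < r" using that \<eta> by (auto simp: \<eta>_def)
    finally have "?p t s \<in> ball x r" by (simp add: dist_norm algebra_simps norm_minus_commute)
    then show ?thesis using r by blast
  qed
  have C: "C1_on S u" "\<And>k. C1_on S (partial k u)" using u by (auto simp: C2_on_def)
  have cp: "continuous_on S (partial k (partial l u))" for k l using C(2) by (auto simp: C1_on_def)
  have ftc: "((\<lambda>s. partial j u (?p t s)) has_integral u (?p t s) - u (?p t 0)) {0..s}"
    if "t \<in> {-\<eta>..\<eta>}" "s \<in> {0..\<eta>}" for t s
  proof (rule fundamental_theorem_of_calculus)
    fix s' assume "s' \<in> {0..s}"
    then have "?p t s' \<in> S" using that by (intro inS) auto
    from has_field_derivative_at_within[OF C1_on_DERIV_axis[OF C(1) this]]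
    show "((\<lambda>s. u (?p t s)) has_vector_derivative partial j u (?p t s')) (at s' within {0..s})"
      by (simp add: has_real_derivative_iff_has_vector_derivative)
  qed (use that in simp)
  have eq: "partial i u (?p 0 s) - partial i u (?p 0 0) = integral {0..s} (\<lambda>\<sigma>. partial i (partial j u) (?p 0 \<sigma>))"
    if s: "s \<in> {0..\<eta>}" for s
  proof -
    have "((\<lambda>t. integral (cbox 0 s) (\<lambda>\<sigma>. partial j u (?p t \<sigma>))) has_real_derivative
            integral (cbox 0 s) (\<lambda>\<sigma>. partial i (partial j u) (?p 0 \<sigma>))) (at 0 within {-\<eta>..\<eta>})"
    proof (rule leibniz_rule_field_derivative)
      fix t \<sigma> assume "t \<in> {-\<eta>..\<eta>}" "\<sigma> \<in> cbox 0 s"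
      then have "?p t \<sigma> \<in> S" using s by (intro inS) auto
      then have "((\<lambda>t. partial j u ((x + \<sigma> *\<^sub>R axis j 1) + t *\<^sub>R axis i 1)) has_real_derivative
          partial i (partial j u) ((x + \<sigma> *\<^sub>R axis j 1) + t *\<^sub>R axis i 1)) (at t)"
        by (intro C1_on_DERIV_axis[OF C(2)]) (simp add: algebra_simps)
      from has_field_derivative_at_within[OF this]
      show "((\<lambda>t. partial j u (?p t \<sigma>)) has_real_derivative partial i (partial j u) (?p t \<sigma>)) (at t within {-\<eta>..\<eta>})"
        by (simp add: algebra_simps)
    next
      fix t assume "t \<in> {-\<eta>..\<eta>}"
      then show "(\<lambda>\<sigma>. partial j u (?p t \<sigma>)) integrable_on cbox 0 s"
        using has_integral_integrable[OF ftc, of t s] s by simp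
    next
      show "continuous_on ({-\<eta>..\<eta>} \<times> cbox 0 s) (\<lambda>(t, \<sigma>). partial i (partial j u) (?p t \<sigma>))"
        unfolding split_beta using s
        by (intro continuous_on_compose2[OF cp] continuous_intros image_subsetI inS) auto
    qed (use \<eta> in auto)
    moreover have "((\<lambda>t. integral (cbox 0 s) (\<lambda>\<sigma>. partial j u (?p t \<sigma>))) has_real_derivative
            partial i u (?p 0 s) - partial i u (?p 0 0)) (at 0 within {-\<eta>..\<eta>})"
    proof (rule has_field_derivative_transform_within[where f = "\<lambda>t. u (?p t s) - u (?p t 0)" and d = 1])
      have D: "((\<lambda>t. u (?p t s)) has_real_derivative partial i u (?p 0 s)) (at 0)"
        if "s \<in> {0..\<eta>}" for s
        using C1_on_DERIV_axis[OF C(1), of "x + s *\<^sub>R axis j 1" 0 i] inS[of 0 s] that \<eta>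
        by (simp add: algebra_simps)
      show "((\<lambda>t. u (?p t s) - u (?p t 0)) has_real_derivative partial i u (?p 0 s) - partial i u (?p 0 0)) (at 0 within {-\<eta>..\<eta>})"
        by (rule has_field_derivative_at_within[OF DERIV_diff[OF D D]]) (use s \<eta> in auto)
      show "u (?p t s) - u (?p t 0) = integral (cbox 0 s) (\<lambda>\<sigma>. partial j u (?p t \<sigma>))" if "t \<in> {-\<eta>..\<eta>}" for t
        using integral_unique[OF ftc[OF that s]] by simp
    qed (use \<eta> in auto)
    ultimately show ?thesis
      using \<eta> vector_derivative_unique_within_closed_interval[of "-\<eta>" \<eta> 0]
      by (simp add: has_real_derivative_iff_has_vector_derivative)
  qed
  have "((\<lambda>s. integral {0..s} (\<lambda>\<sigma>. partial i (partial j u) (?p 0 \<sigma>))) has_real_derivative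
          partial i (partial j u) (?p 0 0)) (at 0 within {0..\<eta>})"
  proof (rule integral_has_real_derivative)
    show "continuous_on {0..\<eta>} (\<lambda>\<sigma>. partial i (partial j u) (?p 0 \<sigma>))"
      by (intro continuous_on_compose2[OF cp] continuous_intros image_subsetI inS) (use \<eta> in auto)
  qed (use \<eta> in simp)
  moreover have "((\<lambda>s. integral {0..s} (\<lambda>\<sigma>. partial i (partial j u) (?p 0 \<sigma>))) has_real_derivative
          partial j (partial i u) (?p 0 0)) (at 0 within {0..\<eta>})"
  proof (rule has_field_derivative_transform_within[where f = "\<lambda>s. partial i u (?p 0 s) - partial i u (?p 0 0)" and d = 1])
    have "((\<lambda>s. partial i u (?p 0 s)) has_real_derivative partial j (partial i u) (?p 0 0)) (at 0)"
      by (rule C1_on_DERIV_axis[OF C(2)]) (use inS[of 0 0] \<eta> in simp)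
    from has_field_derivative_at_within[OF DERIV_diff[OF this DERIV_const]]
    show "((\<lambda>s. partial i u (?p 0 s) - partial i u (?p 0 0)) has_real_derivative partial j (partial i u) (?p 0 0)) (at 0 within {0..\<eta>})"
      by simp
  qed (use \<eta> eq in auto)
  ultimately have "partial i (partial j u) (?p 0 0) = partial j (partial i u) (?p 0 0)"
    using \<eta> vector_derivative_unique_within_closed_interval[of 0 \<eta> 0]
    by (simp add: has_real_derivative_iff_has_vector_derivative)
  then show ?thesis by simp
qed

section \<open>Squares\<close>

lemma mem_square_iff: "x \<in> square y r \<longleftrightarrow> (\<forall>k. \<bar>x $ k - y $ k\<bar> \<le> r)"
proof -
  have "(y $ k - r \<le> x $ k \<and> x $ k \<le> y $ k + r) \<longleftrightarrow> \<bar>x $ k - y $ k\<bar> \<le> r" for k by auto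
  then show ?thesis by (simp add: square_def mem_box_cart)
qed

lemma square_mono: "r \<le> s \<Longrightarrow> square y r \<subseteq> square y s"
  by (meson mem_square_iff order_trans subsetI)

section \<open>Derivatives that are almost monotone\<close>

text \<open>A function \<open>V\<close> which is, up to the bounded term \<open>r\<close>, the derivative of a bounded function \<open>U\<close> takes a moderate
value somewhere on each side of \<open>0\<close> by the mean value theorem.  Since \<open>\<sigma> V\<close> decreases at most at
rate \<open>D\<close>, the value on the right bounds \<open>\<sigma> V(0)\<close> from above, the one on the left from below.\<close>

lemma semi_monotone_near_derivative_bound:
  fixes U V r U' V' :: "real \<Rightarrow> real"
  assumes \<rho>: "\<rho> > 0" and \<sigma>: "\<bar>\<sigma>\<bar> = 1"
    and dU: "\<And>s. s \<in> {-\<rho>..\<rho>} \<Longrightarrow> (U has_real_derivative V s + r s) (at s within {-\<rho>..\<rho>})"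
    and dV: "\<And>s. s \<in> {-\<rho>..\<rho>} \<Longrightarrow> (V has_real_derivative V' s) (at s within {-\<rho>..\<rho>})"
    and bU: "\<And>s. s \<in> {-\<rho>..\<rho>} \<Longrightarrow> \<bar>U s\<bar> \<le> \<rho> * C"
    and br: "\<And>s. s \<in> {-\<rho>..\<rho>} \<Longrightarrow> \<bar>r s\<bar> \<le> c"
    and semi: "\<And>s. s \<in> {-\<rho>..\<rho>} \<Longrightarrow> - D \<le> \<sigma> * V' s" and D: "0 \<le> D"
  shows "\<bar>V 0\<bar> \<le> 2 * C + c + D * \<rho>"
proof -
  have pt: "\<exists>s\<in>{a<..<b}. \<bar>V s\<bar> \<le> 2 * C + c"
    if ab: "b - a = \<rho>" "-\<rho> \<le> a" "b \<le> \<rho>" for a b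
  proof -
    have sub: "{a..b} \<subseteq> {-\<rho>..\<rho>}" using ab by auto
    have "\<exists>s\<in>{a<..<b}. U b - U a = (\<lambda>h. (V s + r s) * h) (b - a)"
    proof (rule mvt_simple)
      show "a < b" using ab \<rho> by simp
      fix s assume "a \<le> s" "s \<le> b"
      then have "s \<in> {-\<rho>..\<rho>}" using sub by auto
      from has_field_derivative_subset[OF dU[OF this] sub]
      show "(U has_derivative (*) (V s + r s)) (at s within {a..b})"
        by (simp add: has_field_derivative_def)
    qed
    then obtain s where s: "s \<in> {a<..<b}" "U b - U a = (V s + r s) * \<rho>" using ab by auto
    have s': "s \<in> {-\<rho>..\<rho>}" using s ab by auto
    have "\<bar>V s + r s\<bar> * \<rho> = \<bar>U b - U a\<bar>" using s(2) \<rho> by (simp add: abs_mult)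
    also have "\<dots> \<le> (2 * C) * \<rho>" using bU[of a] bU[of b] ab \<rho> by (simp add: algebra_simps abs_le_iff)
    finally have "\<bar>V s + r s\<bar> \<le> 2 * C" using \<rho> by simp
    then have "\<bar>V s\<bar> \<le> 2 * C + c" using br[OF s'] by linarith
    then show ?thesis using s(1) by blast
  qed
  have mono: "\<sigma> * V s \<le> \<sigma> * V t + D * (t - s)" if st: "-\<rho> \<le> s" "s \<le> t" "t \<le> \<rho>" for s t
  proof -
    have sub: "{s..t} \<subseteq> {-\<rho>..\<rho>}" using st by auto
    have "\<exists>z\<in>{s..t}. (\<lambda>z. \<sigma> * V z + D * z) t - (\<lambda>z. \<sigma> * V z + D * z) s = (\<lambda>h. (\<sigma> * V' z + D) * h) (t - s)"
    proof (rule mvt_very_simple[OF st(2)])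
      fix z assume "s \<le> z" "z \<le> t"
      then have "z \<in> {-\<rho>..\<rho>}" using sub by auto
      from has_field_derivative_subset[OF dV[OF this] sub]
      have "((\<lambda>z. \<sigma> * V z + D * z) has_real_derivative \<sigma> * V' z + D) (at z within {s..t})"
        by (auto intro!: derivative_eq_intros)
      then show "((\<lambda>z. \<sigma> * V z + D * z) has_derivative (*) (\<sigma> * V' z + D)) (at z within {s..t})"
        by (simp add: has_field_derivative_def)
    qed
    then obtain z where z: "z \<in> {s..t}" "\<sigma> * V t + D * t - (\<sigma> * V s + D * s) = (\<sigma> * V' z + D) * (t - s)" by auto
    have "0 \<le> (\<sigma> * V' z + D) * (t - s)"
      using semi[of z] z(1) st by (intro mult_nonneg_nonneg) auto
    then show ?thesis using z(2) by (simp add: algebra_simps)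
  qed
  obtain s where s: "s \<in> {0<..<\<rho>}" "\<bar>V s\<bar> \<le> 2 * C + c" using pt[of \<rho> 0] \<rho> by auto
  obtain s' where s': "s' \<in> {-\<rho><..<0}" "\<bar>V s'\<bar> \<le> 2 * C + c" using pt[of 0 "-\<rho>"] \<rho> by auto
  have abs_\<sigma>: "\<bar>\<sigma> * x\<bar> = \<bar>x\<bar>" for x using \<sigma> by (simp add: abs_mult)
  have "\<sigma> * V 0 \<le> \<sigma> * V s + D * s" using mono[of 0 s] s(1) \<rho> by simp
  moreover have "D * s \<le> D * \<rho>" using s(1) D by (intro mult_left_mono) auto
  moreover have "\<sigma> * V s' \<le> \<sigma> * V 0 + D * (- s')" using mono[of s' 0] s'(1) \<rho> by simp
  moreover have "D * (- s') \<le> D * \<rho>" using s'(1) D by (intro mult_left_mono) auto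
  moreover have "\<bar>\<sigma> * V s\<bar> \<le> 2 * C + c" "\<bar>\<sigma> * V s'\<bar> \<le> 2 * C + c" using s(2) s'(2) abs_\<sigma> by simp_all
  ultimately have "\<bar>\<sigma> * V 0\<bar> \<le> 2 * C + c + D * \<rho>" by linarith
  then show ?thesis using abs_\<sigma> by simp
qed

section \<open>The gradient at the centre of a square\<close>

text \<open>A square on which everything is under control, with \<open>G\<close> a bound for the derivatives
of \<open>u\<close> and \<open>K\<close> one for the lower order terms; both will depend on \<open>u\<close>.  The inequalities are in
nondivergence form and hold at every point, and the coefficients are Lipschitz, with
constant \<open>C1\<close> for the \<open>\<ell>\<^sup>1\<close> distance.\<close>

locale flux_box =
  fixes S :: "(real^2) set" and x0 :: "real^2" and R :: real
    and A :: "real^2 \<Rightarrow> real^2^2" and u :: "real^2 \<Rightarrow> real" and C1 m C5 G K :: real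
  assumes open_S: "open S" and u_C2: "C2_on S u" and box: "square x0 R \<subseteq> S"
    and C1_pos: "C1 > 0" and m_pos: "m > 0" and K_nonneg: "K \<ge> 0"
    and A_cont: "\<And>i j. continuous_on (square x0 R) (\<lambda>x. A x $ i $ j)"
    and A_le: "\<And>i j x. x \<in> square x0 R \<Longrightarrow> \<bar>A x $ i $ j\<bar> \<le> C1"
    and A_lip: "\<And>i j x y. x \<in> square x0 R \<Longrightarrow> y \<in> square x0 R \<Longrightarrow>
                  \<bar>A x $ i $ j - A y $ i $ j\<bar> \<le> C1 * (\<Sum>k\<in>UNIV. \<bar>x $ k - y $ k\<bar>)"
    and A_diag: "\<And>i x. x \<in> square x0 R \<Longrightarrow> m \<le> \<bar>A x $ i $ i\<bar>"
    and grad_le: "\<And>k x. x \<in> square x0 R \<Longrightarrow> \<bar>partial k u x\<bar> \<le> G"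
    and u_le: "\<And>x. x \<in> square x0 R \<Longrightarrow> \<bar>u x\<bar> \<le> C5"
    and ineq: "\<And>i x. x \<in> square x0 R \<Longrightarrow>
                  - K \<le> (\<Sum>j\<in>UNIV. A x $ i $ j * partial i (partial j u) x)"
begin

lemma C1u: "C1_on S u" and C1pu: "C1_on S (partial k u)"
  using u_C2 by (auto simp: C2_on_def)

lemma cont_partial: "continuous_on S (partial k u)"
  using C1u by (auto simp: C1_on_def)

lemma cont_partial2: "continuous_on S (partial l (partial k u))"
  using C1pu by (auto simp: C1_on_def)

lemma square_x0_nonempty: "0 \<le> R \<Longrightarrow> x0 \<in> square x0 R"
  by (simp add: mem_square_iff)

lemma G_nonneg: "0 \<le> R \<Longrightarrow> 0 \<le> G"
  using grad_le[OF square_x0_nonempty] by (meson abs_ge_zero order_trans)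

text \<open>The derivative of this flux along \<open>e\<^sub>i\<close> is the left hand side of the \<open>i\<close>-th inequality, with coefficients taken at
\<open>x0\<close>.  For each of the two terms, moving the coefficient to \<open>x0\<close> costs at most
\<open>2 C1 G (b - a)\<close> after integration by parts along the segment.  The segment contains \<open>x0\<close>,
where the error of the coefficient vanishes.\<close>

lemma frozen_flux_semi_monotone:
  assumes ab: "a \<le> 0" "0 \<le> b" "- R \<le> a" "b \<le> R"
  shows "(\<Sum>k\<in>UNIV. A x0 $ i $ k * partial k u (x0 + a *\<^sub>R axis i 1))
       \<le> (\<Sum>k\<in>UNIV. A x0 $ i $ k * partial k u (x0 + b *\<^sub>R axis i 1)) + (K + 4 * C1 * G) * (b - a)"
proof -
  let ?p = "\<lambda>t. x0 + t *\<^sub>R axis i 1 :: real^2"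
  have inQ: "?p t \<in> square x0 R" if "t \<in> {a..b}" for t
    using that ab by (auto simp: mem_square_iff axis_def)
  note inS = subsetD[OF box inQ]
  have cp: "continuous_on {a..b} (\<lambda>t. partial i (partial k u) (?p t))" for k
    by (intro continuous_on_compose2[OF cont_partial2] continuous_intros image_subsetI inS)
  have cA: "continuous_on {a..b} (\<lambda>t. A (?p t) $ i $ k)" for k
    by (intro continuous_on_compose2[OF A_cont] continuous_intros image_subsetI inQ)
  have D: "((\<lambda>t. partial k u (?p t)) has_real_derivative partial i (partial k u) (?p t)) (at t)"
    if "t \<in> {a..b}" for k t
    by (rule C1_on_DERIV_axis[OF C1pu inS[OF that]])
  have ftc: "integral {a..b} (\<lambda>t. partial i (partial k u) (?p t)) = partial k u (?p b) - partial k u (?p a)" for k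
    by (intro integral_unique fundamental_theorem_of_calculus)
      (use ab D in \<open>auto simp flip: has_real_derivative_iff_has_vector_derivative
          simp: has_field_derivative_at_within\<close>)
  have err: "\<bar>integral {a..b} (\<lambda>t. (A (?p t) $ i $ k - A x0 $ i $ k) * partial i (partial k u) (?p t))\<bar>
      \<le> (2 * C1 * (b - a)) * G" for k
  proof -
    let ?g = "\<lambda>t. A (?p t) $ i $ k - A x0 $ i $ k"
    have lip: "\<bar>A (?p s) $ i $ k - A (?p t) $ i $ k\<bar> \<le> C1 * \<bar>s - t\<bar>" if "s \<in> {a..b}" "t \<in> {a..b}" for s t
    proof -
      have "(\<Sum>l\<in>UNIV. \<bar>?p s $ l - ?p t $ l\<bar>) = \<bar>s - t\<bar>"
        using exhaust_2[of i] by (auto simp: axis_def sum_2)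
      then show ?thesis using A_lip[OF inQ[OF that(1)] inQ[OF that(2)], of i k] by simp
    qed
    have "\<bar>integral {a..b} (\<lambda>t. ?g t * partial i (partial k u) (?p t))\<bar> \<le> (\<bar>?g a\<bar> + \<bar>?g b\<bar> + C1 * (b - a)) * G"
      by (rule integral_Lipschitz_times_derivative[OF _ _ D cp])
        (use ab lip inQ grad_le in auto)
    also have "\<dots> \<le> (2 * C1 * (b - a)) * G"
    proof (rule mult_right_mono)
      have "\<bar>?g a\<bar> \<le> C1 * (- a)" "\<bar>?g b\<bar> \<le> C1 * b" using lip[of a 0] lip[of b 0] ab by auto
      then show "\<bar>?g a\<bar> + \<bar>?g b\<bar> + C1 * (b - a) \<le> 2 * C1 * (b - a)" by (simp add: algebra_simps)
      show "0 \<le> G" by (rule G_nonneg) (use ab in linarith)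
    qed
    finally show ?thesis .
  qed
  let ?I = "\<lambda>k. integral {a..b} (\<lambda>t. A (?p t) $ i $ k * partial i (partial k u) (?p t))"
  have int: "(\<lambda>t. A (?p t) $ i $ k * partial i (partial k u) (?p t)) integrable_on {a..b}" for k
    by (intro integrable_continuous_real continuous_intros cA cp)
  have int': "(\<lambda>t. A x0 $ i $ k * partial i (partial k u) (?p t)) integrable_on {a..b}" for k
    by (intro integrable_continuous_real continuous_intros cp)
  have "- K * (b - a) = integral {a..b} (\<lambda>t. - K)" using ab by simp
  also have "\<dots> \<le> integral {a..b} (\<lambda>t. \<Sum>k\<in>UNIV. A (?p t) $ i $ k * partial i (partial k u) (?p t))"
    by (intro integral_le integrable_sum int) (use ineq inQ in auto)
  also have "\<dots> = (\<Sum>k\<in>UNIV. ?I k)" by (intro integral_sum int) simp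
  also have "\<dots> \<le> (\<Sum>k\<in>UNIV. A x0 $ i $ k * (partial k u (?p b) - partial k u (?p a)) + (2 * C1 * (b - a)) * G)"
  proof (rule sum_mono)
    fix k
    have "integral {a..b} (\<lambda>t. (A (?p t) $ i $ k - A x0 $ i $ k) * partial i (partial k u) (?p t))
        = ?I k - A x0 $ i $ k * (partial k u (?p b) - partial k u (?p a))"
      unfolding left_diff_distrib integral_diff[OF int int'] by (simp add: ftc)
    then show "?I k \<le> A x0 $ i $ k * (partial k u (?p b) - partial k u (?p a)) + (2 * C1 * (b - a)) * G"
      using err[of k] by linarith
  qed
  also have "\<dots> = (\<Sum>k\<in>UNIV. A x0 $ i $ k * partial k u (?p b)) - (\<Sum>k\<in>UNIV. A x0 $ i $ k * partial k u (?p a))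
      + (4 * C1 * G) * (b - a)"
    by (simp add: sum.distrib sum_subtractf right_diff_distrib left_diff_distrib algebra_simps)
  finally show ?thesis by (simp add: algebra_simps)
qed

end

context flux_box begin

text \<open>The \<open>j\<close>-th inequality bounds the mean of \<open>\<partial>\<^sub>j u\<close> over segments parallel to \<open>e\<^sub>i\<close>: sliding the
segment along \<open>v = q(x0) e\<^sub>i + e\<^sub>j\<close>, on which \<open>\<partial>\<^sub>j u\<close> is almost monotone, reduces
the claim to \<open>semi_monotone_near_derivative_bound\<close>.  The constants are explicit: \<open>\<kappa>\<close> bounds \<open>q\<close>, \<open>Lq\<close> is
a Lipschitz constant of \<open>q\<close>, and \<open>\<rho> (1 + \<kappa>) \<le> R\<close> keeps the translated segments in the square.\<close>

lemma transverse_line_integral_bound: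
  fixes i j :: 2
  defines "\<kappa> \<equiv> C1 / m" and "Lq \<equiv> C1 / m + C1\<^sup>2 / m\<^sup>2"
  assumes ij: "i \<noteq> j" and \<rho>: "0 < \<rho>" "\<rho> * (1 + \<kappa>) \<le> R"
    and ab: "- \<rho> \<le> a" "b \<le> \<rho>" "b - a = \<rho>"
  shows "\<bar>integral {a..b} (\<lambda>t. partial j u (x0 + t *\<^sub>R axis i 1))\<bar>
      \<le> 2 * C5 * (1 + \<kappa>) + \<rho>\<^sup>2 * (K / m + Lq * G * (5 + 2 * \<kappa>))"
proof -
  have \<kappa>0: "0 < \<kappa>" using C1_pos m_pos by (simp add: \<kappa>_def)
  have Lq0: "0 < Lq" using C1_pos m_pos by (simp add: Lq_def add_pos_pos)
  have \<rho>R: "\<rho> \<le> R"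
  proof -
    have "\<rho> * 1 \<le> \<rho> * (1 + \<kappa>)" using \<rho>(1) \<kappa>0 by (intro mult_left_mono) auto
    then show ?thesis using \<rho>(2) by simp
  qed
  then have R0: "0 \<le> R" using \<rho>(1) by simp
  have x0Q: "x0 \<in> square x0 R" by (rule square_x0_nonempty[OF R0])
  have G0: "0 \<le> G" by (rule G_nonneg[OF R0])
  have C50: "0 \<le> C5" using u_le[OF x0Q] by linarith
  define q where "q x = A x $ j $ i / A x $ j $ j" for x
  have Ajj: "A x $ j $ j \<noteq> 0" if "x \<in> square x0 R" for x
    using A_diag[OF that, of j] m_pos by auto
  have q_le: "\<bar>q x\<bar> \<le> \<kappa>" if x: "x \<in> square x0 R" for x
    unfolding q_def \<kappa>_def abs_divide
    using A_le[OF x, of j i] A_diag[OF x, of j] m_pos C1_pos by (intro frac_le) auto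
  have q_cont: "continuous_on (square x0 R) q"
    unfolding q_def by (intro continuous_intros A_cont ballI Ajj)
  have q_lip: "\<bar>q x - q y\<bar> \<le> Lq * (\<Sum>k\<in>UNIV. \<bar>x $ k - y $ k\<bar>)"
    if x: "x \<in> square x0 R" and y: "y \<in> square x0 R" for x y
  proof -
    let ?d = "\<Sum>k\<in>UNIV. \<bar>x $ k - y $ k\<bar>"
    have "q x - q y = (A x $ j $ i - A y $ j $ i) / A x $ j $ j + q y * ((A y $ j $ j - A x $ j $ j) / A x $ j $ j)"
      unfolding q_def using Ajj[OF x] Ajj[OF y] by (simp add: field_simps)
    also have "\<bar>\<dots>\<bar> \<le> \<bar>(A x $ j $ i - A y $ j $ i) / A x $ j $ j\<bar> + \<bar>q y\<bar> * \<bar>(A y $ j $ j - A x $ j $ j) / A x $ j $ j\<bar>"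
      by (rule order_trans[OF abs_triangle_ineq]) (simp add: abs_mult)
    also have "\<dots> \<le> C1 * ?d / m + \<kappa> * (C1 * ?d / m)"
    proof -
      have d0: "0 \<le> C1 * ?d" using C1_pos by (simp add: sum_nonneg)
      have "\<bar>(A x $ j $ i - A y $ j $ i) / A x $ j $ j\<bar> \<le> C1 * ?d / m"
        unfolding abs_divide using A_lip[OF x y, of j i] A_diag[OF x, of j] m_pos d0 by (intro frac_le) auto
      moreover have "\<bar>(A y $ j $ j - A x $ j $ j) / A x $ j $ j\<bar> \<le> C1 * ?d / m"
        unfolding abs_divide using A_lip[OF x y, of j j] A_diag[OF x, of j] m_pos d0
        by (intro frac_le) (auto simp: abs_minus_commute)
      ultimately show ?thesis using q_le[OF y] \<kappa>0 by (intro add_mono mult_mono) auto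
    qed
    also have "\<dots> = Lq * ?d"
      using m_pos by (simp add: Lq_def \<kappa>_def field_simps power2_eq_square)
    finally show ?thesis .
  qed
  \<comment> \<open>The diagonal entry has one sign on the connected square; this sign decides whether \<open>\<partial>\<^sub>j u\<close> is
      almost increasing or almost decreasing along \<open>v\<close>.\<close>
  obtain \<sigma> :: real where \<sigma>: "\<bar>\<sigma>\<bar> = 1" "\<And>x. x \<in> square x0 R \<Longrightarrow> \<bar>A x $ j $ j\<bar> = \<sigma> * A x $ j $ j"
  proof -
    have "connected ((\<lambda>x. A x $ j $ j) ` square x0 R)"
      by (intro connected_continuous_image A_cont) (simp add: square_def convex_connected)
    then have iv: "is_interval ((\<lambda>x. A x $ j $ j) ` square x0 R)"
      by (simp add: is_interval_connected_1)
    have "0 \<notin> (\<lambda>x. A x $ j $ j) ` square x0 R" using Ajj by auto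
    then have "(\<forall>x\<in>square x0 R. 0 < A x $ j $ j) \<or> (\<forall>x\<in>square x0 R. A x $ j $ j < 0)"
      using iv unfolding is_interval_1 by (smt (verit, best) image_eqI)
    then show ?thesis using that[of 1] that[of "-1"] by fastforce
  qed
  define q0 where "q0 = q x0"
  define v :: "real^2" where "v = q0 *\<^sub>R axis i 1 + axis j 1"
  define p where "p t s = x0 + t *\<^sub>R axis i 1 + s *\<^sub>R v" for t s
  have v_comp: "v $ i = q0" "v $ j = 1" using ij by (auto simp: v_def axis_def)
  have p_comp: "p t s $ i = x0 $ i + (t + s * q0)" "p t s $ j = x0 $ j + s" for t s
    using ij by (auto simp: p_def v_comp) (auto simp: axis_def)
  have q0_le: "\<bar>q0\<bar> \<le> \<kappa>" unfolding q0_def by (rule q_le[OF x0Q])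
  have sq0: "\<bar>s * q0\<bar> \<le> \<rho> * \<kappa>" if "s \<in> {-\<rho>..\<rho>}" for s
    unfolding abs_mult using that q0_le \<rho>(1) by (intro mult_mono) auto
  have inQ: "p t s \<in> square x0 R" if t: "t \<in> {a..b}" and s: "s \<in> {-\<rho>..\<rho>}" for t s
  proof -
    have "\<bar>t + s * q0\<bar> \<le> \<rho> + \<rho> * \<kappa>" using sq0[OF s] t ab by auto
    then have "\<bar>t + s * q0\<bar> \<le> R" "\<bar>s\<bar> \<le> R" using \<rho>(2) \<rho>R s by (auto simp: algebra_simps)
    then have "\<forall>k\<in>{i,j}. \<bar>p t s $ k - x0 $ k\<bar> \<le> R" by (simp add: p_comp)
    then show ?thesis unfolding mem_square_iff using UNIV_eq_2[OF ij] by auto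
  qed
  note inS = subsetD[OF box inQ]
  have cont_p: "continuous_on ({-\<rho>..\<rho>} \<times> {a..b}) (\<lambda>z. f (p (snd z) (fst z)))"
    if "continuous_on S f" for f :: "real^2 \<Rightarrow> real"
    unfolding p_def
    by (intro continuous_on_compose2[OF that] continuous_intros)
       (use inS in \<open>auto simp: p_def\<close>)
  have cont_t: "continuous_on {a..b} (\<lambda>t. f (p t s))" if "continuous_on (square x0 R) f" "s \<in> {-\<rho>..\<rho>}"
    for f :: "real^2 \<Rightarrow> real" and s
    unfolding p_def
    by (intro continuous_on_compose2[OF that(1)] continuous_intros)
       (use inQ that(2) in \<open>auto simp: p_def\<close>)
  have cQ: "continuous_on (square x0 R) f" if "continuous_on S f" for f :: "real^2 \<Rightarrow> real"
    using continuous_on_subset[OF that box] .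
  have D_s: "((\<lambda>s. integral {a..b} (\<lambda>t. f (p t s))) has_real_derivative
        integral {a..b} (\<lambda>t. partial j f (p t s) + q0 * partial i f (p t s))) (at s within {-\<rho>..\<rho>})"
    if f: "C1_on S f" and s: "s \<in> {-\<rho>..\<rho>}" for f s
  proof -
    have "((\<lambda>s. integral (cbox a b) (\<lambda>t. f (p t s))) has_real_derivative
        integral (cbox a b) (\<lambda>t. partial j f (p t s) + q0 * partial i f (p t s))) (at s within {-\<rho>..\<rho>})"
    proof (rule leibniz_rule_field_derivative[OF _ _ _ s])
      fix s t assume st: "s \<in> {-\<rho>..\<rho>}" "t \<in> cbox a b"
      then have "p t s \<in> S" using inS by auto
      then have "((\<lambda>s. f ((x0 + t *\<^sub>R axis i 1) + s *\<^sub>R v)) has_real_derivative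
           (\<Sum>k\<in>UNIV. partial k f ((x0 + t *\<^sub>R axis i 1) + s *\<^sub>R v) * v $ k)) (at s)"
        by (intro C1_on_DERIV_line[OF f]) (simp add: p_def)
      from has_field_derivative_at_within[OF this]
      show "((\<lambda>s. f (p t s)) has_real_derivative partial j f (p t s) + q0 * partial i f (p t s)) (at s within {-\<rho>..\<rho>})"
        by (simp add: p_def sum_UNIV_2[OF ij] v_comp add.commute mult.commute)
    next
      fix s assume s: "s \<in> {-\<rho>..\<rho>}"
      show "(\<lambda>t. f (p t s)) integrable_on cbox a b"
        using cont_t[OF cQ[OF C1_on_continuous_on[OF f]] s] by (simp add: integrable_continuous_real)
    next
      have "continuous_on S (\<lambda>x. partial j f x + q0 * partial i f x)"
        using f by (intro continuous_intros) (auto simp: C1_on_def)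
      from cont_p[OF this]
      show "continuous_on ({-\<rho>..\<rho>} \<times> cbox a b) (\<lambda>(s, t). partial j f (p t s) + q0 * partial i f (p t s))"
        by (simp add: split_beta)
    qed simp
    then show ?thesis by simp
  qed
  have D_t: "((\<lambda>t. f (p t s)) has_real_derivative partial i f (p t s)) (at t)"
    if f: "C1_on S f" and st: "s \<in> {-\<rho>..\<rho>}" "t \<in> {a..b}" for f s t
  proof -
    have "((\<lambda>t. f ((x0 + s *\<^sub>R v) + t *\<^sub>R axis i 1)) has_real_derivative
           partial i f ((x0 + s *\<^sub>R v) + t *\<^sub>R axis i 1)) (at t)"
      by (intro C1_on_DERIV_axis[OF f]) (use inS[OF st(2,1)] in \<open>simp add: p_def algebra_simps\<close>)
    then show ?thesis by (simp add: p_def algebra_simps)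
  qed
  \<comment> \<open>By \<open>D_s\<close> for \<open>f = u\<close>, \<open>U' = V + q0 [u]\<close> with the jump of \<open>u\<close> between the ends of the segment.\<close>
  define U where "U s = integral {a..b} (\<lambda>t. u (p t s))" for s
  define V where "V s = integral {a..b} (\<lambda>t. partial j u (p t s))" for s
  define V' where "V' s = integral {a..b} (\<lambda>t. partial j (partial j u) (p t s) + q0 * partial i (partial j u) (p t s))" for s
  define E where "E = K / m + Lq * G * (5 + 2 * \<kappa>)"
  have "\<bar>V 0\<bar> \<le> 2 * C5 + 2 * \<kappa> * C5 + (E * \<rho>) * \<rho>"
  proof (rule semi_monotone_near_derivative_bound[OF \<rho>(1) \<sigma>(1)])
    fix s assume s: "s \<in> {-\<rho>..\<rho>}"
    have int: "(\<lambda>t. f (p t s)) integrable_on {a..b}" if "continuous_on (square x0 R) f" for f :: "real^2 \<Rightarrow> real"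
      by (intro integrable_continuous_real cont_t that s)
    have ftc: "integral {a..b} (\<lambda>t. partial i u (p t s)) = u (p b s) - u (p a s)"
      by (intro integral_unique fundamental_theorem_of_calculus)
        (use ab \<rho>(1) D_t[OF C1u s] in \<open>auto simp flip: has_real_derivative_iff_has_vector_derivative
          simp: has_field_derivative_at_within\<close>)
    have "integral {a..b} (\<lambda>t. partial j u (p t s) + q0 * partial i u (p t s)) = V s + q0 * (u (p b s) - u (p a s))"
      unfolding V_def
      by (subst integral_add)
         (auto intro!: int cQ continuous_intros cont_partial simp: ftc)
    with D_s[OF C1u s]
    show "(U has_real_derivative V s + q0 * (u (p b s) - u (p a s))) (at s within {-\<rho>..\<rho>})"
      unfolding U_def[abs_def] by simp
    show "(V has_real_derivative V' s) (at s within {-\<rho>..\<rho>})"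
      unfolding V_def[abs_def] V'_def by (rule D_s[OF C1pu s])
    have "norm (integral {a..b} (\<lambda>t. u (p t s))) \<le> C5 * (b - a)"
    proof (rule integral_bound)
      show "a \<le> b" using ab \<rho> by simp
      show "continuous_on {a..b} (\<lambda>t. u (p t s))"
        by (intro cont_t cQ C1_on_continuous_on C1u s)
      show "norm (u (p t s)) \<le> C5" if "t \<in> {a..b}" for t using u_le[OF inQ[OF that s]] by simp
    qed
    then show "\<bar>U s\<bar> \<le> \<rho> * C5" using ab by (simp add: U_def mult.commute)
    have "a \<in> {a..b}" "b \<in> {a..b}" using ab \<rho> by auto
    then have "\<bar>u (p b s) - u (p a s)\<bar> \<le> 2 * C5"
      using u_le[OF inQ[OF _ s], of a] u_le[OF inQ[OF _ s], of b] by linarith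
    then have "\<bar>q0 * (u (p b s) - u (p a s))\<bar> \<le> \<kappa> * (2 * C5)"
      unfolding abs_mult using q0_le \<kappa>0 by (intro mult_mono) auto
    then show "\<bar>q0 * (u (p b s) - u (p a s))\<bar> \<le> 2 * \<kappa> * C5" by simp
    show "- (E * \<rho>) \<le> \<sigma> * V' s"
    proof -
      let ?ujj = "partial j (partial j u)" and ?uij = "partial i (partial j u)"
      let ?g = "\<lambda>t. q (p t s) - q0"
      have g_lip: "\<bar>?g t - ?g t'\<bar> \<le> Lq * \<bar>t - t'\<bar>" if "t \<in> {a..b}" "t' \<in> {a..b}" for t t'
        using q_lip[OF inQ[OF that(1) s] inQ[OF that(2) s]] by (simp add: sum_UNIV_2[OF ij] p_comp)
      have g_le: "\<bar>?g t\<bar> \<le> Lq * (\<rho> * (2 + \<kappa>))" if t: "t \<in> {a..b}" for t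
      proof -
        have "\<bar>?g t\<bar> \<le> Lq * (\<bar>t + s * q0\<bar> + \<bar>s\<bar>)"
          using q_lip[OF inQ[OF t s] x0Q] by (simp add: sum_UNIV_2[OF ij] p_comp q0_def)
        also have "\<dots> \<le> Lq * (\<rho> * (2 + \<kappa>))"
        proof (rule mult_left_mono)
          have "\<bar>t\<bar> \<le> \<rho>" "\<bar>s\<bar> \<le> \<rho>" using t s ab by auto
          then show "\<bar>t + s * q0\<bar> + \<bar>s\<bar> \<le> \<rho> * (2 + \<kappa>)" using sq0[OF s] by (simp add: algebra_simps)
        qed (use Lq0 in simp)
        finally show ?thesis .
      qed
      have err: "\<bar>integral {a..b} (\<lambda>t. ?g t * ?uij (p t s))\<bar> \<le> Lq * G * (5 + 2 * \<kappa>) * \<rho>"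
      proof -
        have "\<bar>integral {a..b} (\<lambda>t. ?g t * ?uij (p t s))\<bar> \<le> (\<bar>?g a\<bar> + \<bar>?g b\<bar> + Lq * (b - a)) * G"
        proof (rule integral_Lipschitz_times_derivative)
          show "a \<le> b" using ab \<rho> by simp
          show "((\<lambda>t. partial j u (p t s)) has_real_derivative ?uij (p t s)) (at t)" if "t \<in> {a..b}" for t
            by (rule D_t[OF C1pu s that])
          show "continuous_on {a..b} (\<lambda>t. ?uij (p t s))"
            by (intro cont_t cQ cont_partial2 s)
          show "\<bar>partial j u (p t s)\<bar> \<le> G" if "t \<in> {a..b}" for t by (rule grad_le[OF inQ[OF that s]])
        qed (rule g_lip)
        also have "\<dots> \<le> (Lq * (\<rho> * (2 + \<kappa>)) + Lq * (\<rho> * (2 + \<kappa>)) + Lq * \<rho>) * G"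
          using g_le[of a] g_le[of b] ab \<rho> G0 by (intro mult_right_mono add_mono) auto
        finally show ?thesis by (simp add: algebra_simps)
      qed
      have pw: "- (K / m) \<le> \<sigma> * (?ujj (p t s) + q (p t s) * ?uij (p t s))" if t: "t \<in> {a..b}" for t
      proof -
        let ?x = "p t s"
        have xQ: "?x \<in> square x0 R" by (rule inQ[OF t s])
        \<comment> \<open>The inequality contains \<open>\<partial>\<^sub>j \<partial>\<^sub>i u\<close>; the derivative along the segment is \<open>\<partial>\<^sub>i \<partial>\<^sub>j u\<close>.\<close>
        have comm: "partial j (partial i u) ?x = ?uij ?x"
          by (rule C2_on_mixed_partials_commute[OF open_S u_C2]) (use xQ box ij in auto)
        have "A ?x $ j $ j * q ?x = A ?x $ j $ i" using Ajj[OF xQ] by (simp add: q_def)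
        then have "A ?x $ j $ j * (?ujj ?x + q ?x * ?uij ?x) = A ?x $ j $ j * ?ujj ?x + A ?x $ j $ i * ?uij ?x"
          by (simp add: distrib_left flip: mult.assoc)
        then have "- K \<le> A ?x $ j $ j * (?ujj ?x + q ?x * ?uij ?x)"
          using ineq[OF xQ, of j] by (simp add: sum_UNIV_2[OF ij] comm)
        also have "\<dots> = (\<sigma> * A ?x $ j $ j) * (\<sigma> * (?ujj ?x + q ?x * ?uij ?x))"
          using \<sigma>(1) by (cases "\<sigma> = 1") (auto simp: abs_if split: if_splits)
        also have "\<dots> = \<bar>A ?x $ j $ j\<bar> * (\<sigma> * (?ujj ?x + q ?x * ?uij ?x))" using \<sigma>(2)[OF xQ] by simp
        finally have main: "- K \<le> \<bar>A ?x $ j $ j\<bar> * (\<sigma> * (?ujj ?x + q ?x * ?uij ?x))" .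
        show ?thesis
        proof (rule ccontr)
          assume "\<not> ?thesis"
          then have neg: "\<sigma> * (?ujj ?x + q ?x * ?uij ?x) < - (K / m)" by simp
          have Km: "0 \<le> K / m" using K_nonneg m_pos by simp
          have "\<bar>A ?x $ j $ j\<bar> * (\<sigma> * (?ujj ?x + q ?x * ?uij ?x)) \<le> m * (\<sigma> * (?ujj ?x + q ?x * ?uij ?x))"
            using A_diag[OF xQ, of j] neg Km by (intro mult_right_mono_neg) auto
          also have "\<dots> < m * (- (K / m))" using neg m_pos by (intro mult_strict_left_mono) auto
          finally show False using main m_pos by simp
        qed
      qed
      \<comment> \<open>Unfreezing \<open>q0\<close> costs the integral of \<open>(q - q0) \<partial>\<^sub>i \<partial>\<^sub>j u\<close>, whose second derivative is along the
          segment, so that \<open>err\<close> applies.\<close>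
      have "\<sigma> * V' s = integral {a..b} (\<lambda>t. \<sigma> * (?ujj (p t s) + q (p t s) * ?uij (p t s)))
          - \<sigma> * integral {a..b} (\<lambda>t. ?g t * ?uij (p t s))"
      proof -
        have "V' s = integral {a..b} (\<lambda>t. (?ujj (p t s) + q (p t s) * ?uij (p t s)) - ?g t * ?uij (p t s))"
          unfolding V'_def by (rule integral_cong) (simp add: algebra_simps)
        also have "\<dots> = integral {a..b} (\<lambda>t. ?ujj (p t s) + q (p t s) * ?uij (p t s))
             - integral {a..b} (\<lambda>t. ?g t * ?uij (p t s))"
          by (intro integral_diff int[of "\<lambda>x. ?ujj x + q x * ?uij x"] int[of "\<lambda>x. (q x - q0) * ?uij x"]
                continuous_intros cQ cont_partial2 q_cont)
        finally show ?thesis by (simp add: right_diff_distrib)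
      qed
      moreover have "integral {a..b} (\<lambda>t. - (K / m)) \<le> integral {a..b} (\<lambda>t. \<sigma> * (?ujj (p t s) + q (p t s) * ?uij (p t s)))"
        by (intro integral_le int[of "\<lambda>x. \<sigma> * (?ujj x + q x * ?uij x)"] pw
             continuous_intros cQ cont_partial2 q_cont) auto
      moreover have "integral {a..b} (\<lambda>t. - (K / m)) = - (K / m) * \<rho>" using ab \<rho> by simp
      moreover have "\<bar>\<sigma> * integral {a..b} (\<lambda>t. ?g t * ?uij (p t s))\<bar> \<le> Lq * G * (5 + 2 * \<kappa>) * \<rho>"
        unfolding abs_mult using err \<sigma>(1) by simp
      ultimately have "- (K / m) * \<rho> - Lq * G * (5 + 2 * \<kappa>) * \<rho> \<le> \<sigma> * V' s" by linarith
      moreover have "- (E * \<rho>) = - (K / m) * \<rho> - Lq * G * (5 + 2 * \<kappa>) * \<rho>"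
        by (simp add: E_def left_diff_distrib distrib_right)
      ultimately show ?thesis by simp
    qed
  next
    show "0 \<le> E * \<rho>"
      using K_nonneg m_pos Lq0 G0 \<kappa>0 \<rho> by (simp add: E_def)
  qed
  moreover have "V 0 = integral {a..b} (\<lambda>t. partial j u (x0 + t *\<^sub>R axis i 1))"
    by (simp add: V_def p_def)
  ultimately show ?thesis by (simp add: E_def algebra_simps power2_eq_square)
qed

end

context flux_box begin

text \<open>Up to an error \<open>O(\<rho>)\<close>, the flux at \<open>x0\<close> is at most its mean over the segment that starts there and at
least its mean over the segment that ends there; \<open>transverse_line_integral_bound\<close> bounds both.\<close>

lemma flux_bound:
  fixes i :: 2
  defines "\<kappa> \<equiv> C1 / m" and "Lq \<equiv> C1 / m + C1\<^sup>2 / m\<^sup>2"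
  assumes \<rho>: "0 < \<rho>" "\<rho> * (1 + \<kappa>) \<le> R"
  shows "\<bar>\<Sum>k\<in>UNIV. A x0 $ i $ k * partial k u x0\<bar>
      \<le> 2 * C1 * C5 * (2 + \<kappa>) / \<rho> + \<rho> * (C1 * (K / m + Lq * G * (5 + 2 * \<kappa>)) + K + 4 * C1 * G)"
proof -
  have \<kappa>0: "0 < \<kappa>" using C1_pos m_pos by (simp add: \<kappa>_def)
  have \<rho>R: "\<rho> \<le> R"
  proof -
    have "\<rho> * 1 \<le> \<rho> * (1 + \<kappa>)" using \<rho>(1) \<kappa>0 by (intro mult_left_mono) auto
    then show ?thesis using \<rho>(2) by simp
  qed
  have x0Q: "x0 \<in> square x0 R" using square_x0_nonempty \<rho>R \<rho>(1) by simp
  have G0: "0 \<le> G" using G_nonneg \<rho>R \<rho>(1) by simp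
  obtain j where ij: "i \<noteq> j" using exhaust_2[of i] by (metis zero_neq_one)
  let ?p = "\<lambda>t. x0 + t *\<^sub>R axis i 1 :: real^2"
  define w where "w t = (\<Sum>k\<in>UNIV. A x0 $ i $ k * partial k u (?p t))" for t
  define E where "E = K / m + Lq * G * (5 + 2 * \<kappa>)"
  define M where "M = K + 4 * C1 * G"
  define B where "B = 2 * C1 * C5 * (2 + \<kappa>) + C1 * E * \<rho>\<^sup>2"
  have M0: "0 \<le> M" using K_nonneg C1_pos G0 by (simp add: M_def)
  have inQ: "?p t \<in> square x0 R" if "t \<in> {-\<rho>..\<rho>}" for t
    using that \<rho>R \<rho>(1) by (auto simp: mem_square_iff axis_def)
  note inS = subsetD[OF box inQ]
  have cont: "continuous_on {-\<rho>..\<rho>} (\<lambda>t. partial k u (?p t))" for k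
    by (intro continuous_on_compose2[OF cont_partial] continuous_intros image_subsetI inS)
  have int: "(\<lambda>t. partial k u (?p t)) integrable_on {a..b}" if "-\<rho> \<le> a" "b \<le> \<rho>" for a b k
    by (intro integrable_continuous_real continuous_on_subset[OF cont]) (use that in auto)
  have int_w: "w integrable_on {a..b}" if "-\<rho> \<le> a" "b \<le> \<rho>" for a b
    unfolding w_def by (intro integrable_sum integrable_on_mult_right int that) simp
  have avg: "\<bar>integral {a..b} w\<bar> \<le> B" if ab: "-\<rho> \<le> a" "b \<le> \<rho>" "b - a = \<rho>" for a b
  proof -
    have sub: "t \<in> {-\<rho>..\<rho>}" if "t \<in> {a..b}" for t using that ab by auto
    have "integral {a..b} (\<lambda>t. partial i u (?p t)) = u (?p b) - u (?p a)"
      by (intro integral_unique fundamental_theorem_of_calculus)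
        (use ab \<rho>(1) C1_on_DERIV_axis[OF C1u inS[OF sub]] in
          \<open>auto simp flip: has_real_derivative_iff_has_vector_derivative simp: has_field_derivative_at_within\<close>)
    then have ii: "\<bar>integral {a..b} (\<lambda>t. partial i u (?p t))\<bar> \<le> 2 * C5"
      using u_le[OF inQ, of a] u_le[OF inQ, of b] ab \<rho>(1) by (auto simp: abs_le_iff)
    have jj: "\<bar>integral {a..b} (\<lambda>t. partial j u (?p t))\<bar> \<le> 2 * C5 * (1 + \<kappa>) + \<rho>\<^sup>2 * E"
      unfolding E_def \<kappa>_def Lq_def
      by (rule transverse_line_integral_bound[OF ij \<rho>(1) _ ab]) (use \<rho>(2) in \<open>simp add: \<kappa>_def\<close>)
    have "integral {a..b} w = A x0 $ i $ i * integral {a..b} (\<lambda>t. partial i u (?p t))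
        + A x0 $ i $ j * integral {a..b} (\<lambda>t. partial j u (?p t))"
      unfolding w_def sum_UNIV_2[OF ij]
      by (subst integral_add) (auto intro!: int integrable_on_mult_right ab)
    also have "\<bar>\<dots>\<bar> \<le> \<bar>A x0 $ i $ i\<bar> * \<bar>integral {a..b} (\<lambda>t. partial i u (?p t))\<bar>
        + \<bar>A x0 $ i $ j\<bar> * \<bar>integral {a..b} (\<lambda>t. partial j u (?p t))\<bar>"
      by (rule order_trans[OF abs_triangle_ineq]) (simp add: abs_mult)
    also have "\<dots> \<le> C1 * (2 * C5) + C1 * (2 * C5 * (1 + \<kappa>) + \<rho>\<^sup>2 * E)"
      by (intro add_mono mult_mono ii jj A_le x0Q) (use C1_pos in auto)
    also have "\<dots> = B" by (simp add: B_def algebra_simps)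
    finally show ?thesis .
  qed
  have up: "w 0 - M * \<rho> \<le> w t" if "0 \<le> t" "t \<le> \<rho>" for t
  proof -
    have "w 0 \<le> w t + M * (t - 0)"
      unfolding w_def M_def by (rule frozen_flux_semi_monotone) (use that \<rho>R \<rho>(1) in auto)
    moreover have "M * t \<le> M * \<rho>" using M0 that by (intro mult_left_mono)
    ultimately show ?thesis by simp
  qed
  have down: "w t \<le> w 0 + M * \<rho>" if "-\<rho> \<le> t" "t \<le> 0" for t
  proof -
    have "w t \<le> w 0 + M * (0 - t)"
      unfolding w_def M_def by (rule frozen_flux_semi_monotone) (use that \<rho>R \<rho>(1) in auto)
    moreover have "M * (- t) \<le> M * \<rho>" using M0 that by (intro mult_left_mono) auto
    ultimately show ?thesis by simp
  qed
  have "integral {0..\<rho>} (\<lambda>t. w 0 - M * \<rho>) \<le> integral {0..\<rho>} w"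
    by (intro integral_le int_w) (use up \<rho>(1) in auto)
  then have hi: "\<rho> * (w 0 - M * \<rho>) \<le> B" using avg[of 0 \<rho>] \<rho>(1) by simp
  have "integral {-\<rho>..0} w \<le> integral {-\<rho>..0} (\<lambda>t. w 0 + M * \<rho>)"
    by (intro integral_le int_w) (use down \<rho>(1) in auto)
  then have lo: "- B \<le> \<rho> * (w 0 + M * \<rho>)" using avg[of "-\<rho>" 0] \<rho>(1) by simp
  have "\<rho> * \<bar>w 0\<bar> \<le> B + M * \<rho>\<^sup>2"
    using hi lo \<rho>(1) by (cases "0 \<le> w 0") (auto simp: algebra_simps power2_eq_square)
  then have "\<bar>w 0\<bar> \<le> (B + M * \<rho>\<^sup>2) / \<rho>"
    using \<rho>(1) by (simp add: pos_le_divide_eq mult.commute)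
  also have "\<dots> = 2 * C1 * C5 * (2 + \<kappa>) / \<rho> + \<rho> * (C1 * E + M)"
    using \<rho>(1) by (simp add: B_def field_simps power2_eq_square)
  finally show ?thesis by (simp add: w_def E_def M_def algebra_simps)
qed

text \<open>Cramer's rule recovers the gradient from the two fluxes.\<close>

lemma gradient_bound:
  fixes C2 \<rho> :: real
  defines "\<kappa> \<equiv> C1 / m" and "Lq \<equiv> C1 / m + C1\<^sup>2 / m\<^sup>2"
  assumes \<rho>: "0 < \<rho>" "\<rho> * (1 + \<kappa>) \<le> R"
    and det: "det (A x0) \<noteq> 0" "inverse \<bar>det (A x0)\<bar> \<le> C2"
  shows "norm (grad u x0) \<le> 4 * C1 * C2 *
      (2 * C1 * C5 * (2 + \<kappa>) / \<rho> + \<rho> * (C1 * (K / m + Lq * G * (5 + 2 * \<kappa>)) + K + 4 * C1 * G))"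
    (is "_ \<le> 4 * C1 * C2 * ?B")
proof -
  have "\<rho> * 1 \<le> \<rho> * (1 + \<kappa>)"
    using \<rho>(1) C1_pos m_pos by (intro mult_left_mono) (auto simp: \<kappa>_def)
  then have x0Q: "x0 \<in> square x0 R" using square_x0_nonempty \<rho> by linarith
  define w where "w i = (\<Sum>k\<in>UNIV. A x0 $ i $ k * partial k u x0)" for i
  have w_le: "\<bar>w i\<bar> \<le> ?B" for i
    unfolding w_def \<kappa>_def Lq_def by (rule flux_bound) (use \<rho> in \<open>simp_all add: \<kappa>_def\<close>)
  have B0: "0 \<le> ?B" using w_le[of 1] by (meson abs_ge_zero order_trans)
  have cramer: "\<bar>x\<bar> \<le> C2 * (2 * C1 * ?B)"
    if eq: "det (A x0) * x = c * w i - d * w j" and cd: "\<bar>c\<bar> \<le> C1" "\<bar>d\<bar> \<le> C1" for x c d i j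
  proof -
    have "\<bar>c * w i - d * w j\<bar> \<le> C1 * ?B + C1 * ?B"
      by (rule order_trans[OF abs_triangle_ineq4]) (unfold abs_mult, intro add_mono mult_mono cd w_le, use C1_pos in auto)
    then have le: "\<bar>det (A x0) * x\<bar> \<le> 2 * C1 * ?B" using eq by simp
    have "\<bar>x\<bar> = inverse \<bar>det (A x0)\<bar> * \<bar>det (A x0) * x\<bar>" using det(1) by (simp add: abs_mult)
    also have "\<dots> \<le> C2 * (2 * C1 * ?B)"
      by (intro mult_mono le det(2) order_trans[OF _ det(2)]) auto
    finally show ?thesis .
  qed
  have "\<bar>partial 1 u x0\<bar> \<le> C2 * (2 * C1 * ?B)"
    by (rule cramer[of _ "A x0 $ 2 $ 2" 1 "A x0 $ 1 $ 2" 2])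
      (auto simp: A_le x0Q det_2 w_def sum_2 algebra_simps)
  moreover have "\<bar>partial 2 u x0\<bar> \<le> C2 * (2 * C1 * ?B)"
    by (rule cramer[of _ "A x0 $ 1 $ 1" 2 "A x0 $ 2 $ 1" 1])
      (auto simp: A_le x0Q det_2 w_def sum_2 algebra_simps)
  moreover have "norm (grad u x0) \<le> \<bar>partial 1 u x0\<bar> + \<bar>partial 2 u x0\<bar>"
    using norm_le_l1_cart[of "grad u x0"] by (simp add: sum_2 grad_def)
  ultimately have "norm (grad u x0) \<le> C2 * (2 * C1 * ?B) + C2 * (2 * C1 * ?B)" by linarith
  also have "\<dots> = 4 * C1 * C2 * ?B" by (simp only: mult_ac flip: mult_2)
  finally show ?thesis .
qed

end

section \<open>The interior estimate\<close>

text \<open>The constant that the maximum argument of \<open>interior_gradient_estimate\<close> produces.  Here \<open>\<kappa>\<close>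
bounds the ratios \<open>A\<^sub>j\<^sub>i / A\<^sub>j\<^sub>j\<close> and \<open>\<gamma>\<close> is the factor of \<open>\<rho> sup \<bar>\<nabla>u\<bar>\<close> in the flux estimate.  It depends on \<open>m\<close> only through
\<open>\<kappa>\<close>, in which it is a polynomial with nonnegative coefficients.\<close>

definition gradient_constant :: "real \<Rightarrow> real \<Rightarrow> real \<Rightarrow> real \<Rightarrow> real \<Rightarrow> real \<Rightarrow> real \<Rightarrow> real" where
  "gradient_constant C1 C2 C3 C4 C5 m \<delta> =
     (let \<kappa> = C1 / m;
          \<gamma> = 2 * (C1 + C3) * (1 + \<kappa>) + C1 * \<kappa> * (1 + \<kappa>) * (5 + 2 * \<kappa>) + 4 * C1
      in 32 * C1\<^sup>2 * C2 * C5 * (2 + \<kappa>) * (1 + \<kappa>) / \<delta>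
         + 512 * C1 ^ 3 * C2\<^sup>2 * C5 * (2 + \<kappa>) * \<gamma> + C4 / (2 * C1))"

lemma gradient_constant_pos:
  assumes "C1 > 0" "C2 > 0" "C3 > 0" "C4 > 0" "C5 > 0" "m > 0" "\<delta> > 0"
  shows "0 < gradient_constant C1 C2 C3 C4 C5 m \<delta>"
proof -
  define \<kappa> where "\<kappa> = C1 / m"
  have \<kappa>: "0 < \<kappa>" using assms by (simp add: \<kappa>_def)
  have "0 < 2 * (C1 + C3) * (1 + \<kappa>) + C1 * \<kappa> * (1 + \<kappa>) * (5 + 2 * \<kappa>) + 4 * C1" (is "0 < ?\<gamma>")
    using assms \<kappa> by (simp add: add_pos_pos)
  then have "0 < 32 * C1\<^sup>2 * C2 * C5 * (2 + \<kappa>) * (1 + \<kappa>) / \<delta>" "0 < 512 * C1 ^ 3 * C2\<^sup>2 * C5 * (2 + \<kappa>) * ?\<gamma>"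
      "0 < C4 / (2 * C1)"
    using assms \<kappa> by simp_all
  then show ?thesis unfolding gradient_constant_def Let_def \<kappa>_def by linarith
qed

lemma gradient_constant_bigo: "gradient_constant C1 C2 C3 C4 C5 m \<in> O[at_right 0](\<lambda>\<delta>. 1 / \<delta>)"
proof -
  have "\<exists>a c. gradient_constant C1 C2 C3 C4 C5 m = (\<lambda>\<delta>. a / \<delta> + c)"
    unfolding gradient_constant_def[abs_def] Let_def add.assoc by blast
  then obtain a c where *: "gradient_constant C1 C2 C3 C4 C5 m = (\<lambda>\<delta>. a / \<delta> + c)" by blast
  have "(\<lambda>\<delta>. c :: real) \<in> O[at_right 0](\<lambda>\<delta>. 1 / \<delta>)"
  proof (rule bigoI[of _ "\<bar>c\<bar>"])
    have "\<forall>\<^sub>F \<delta>::real in at_right 0. \<delta> \<in> {0<..<1}"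
      by (rule eventually_at_right_real) simp
    then show "\<forall>\<^sub>F \<delta> in at_right 0. norm c \<le> \<bar>c\<bar> * norm (1 / \<delta> :: real)"
    proof eventually_elim
      case (elim \<delta>)
      then have "\<bar>c\<bar> * 1 \<le> \<bar>c\<bar> * (1 / \<delta>)" by (intro mult_left_mono) auto
      then show ?case using elim by simp
    qed
  qed
  moreover have "(\<lambda>\<delta>. a / \<delta>) \<in> O[at_right 0](\<lambda>\<delta>. 1 / \<delta>)"
    by (rule bigoI[of _ "\<bar>a\<bar>"]) simp
  ultimately show ?thesis unfolding * by (intro sum_in_bigo)
qed

lemma gradient_constant_antimono:
  assumes "C1 > 0" "C2 > 0" "C3 > 0" "C5 > 0" "\<delta> > 0"
  shows "antimono_on {0<..} (\<lambda>m. gradient_constant C1 C2 C3 C4 C5 m \<delta>)"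
proof (rule monotone_onI)
  fix m n :: real assume mn: "m \<in> {0<..}" "n \<in> {0<..}" "m \<le> n"
  then have k: "C1 / n \<le> C1 / m" "0 < C1 / n" "0 < C1 / m" using assms by (auto intro!: divide_left_mono)
  define \<kappa> \<kappa>' where "\<kappa> = C1 / m" and "\<kappa>' = C1 / n"
  have le: "\<kappa>' \<le> \<kappa>" "0 \<le> \<kappa>'" "0 \<le> \<kappa>" using k by (simp_all add: \<kappa>_def \<kappa>'_def)
  have 1: "(2 + \<kappa>') * (1 + \<kappa>') \<le> (2 + \<kappa>) * (1 + \<kappa>)" using le by (intro mult_mono) auto
  have "\<kappa>' * (1 + \<kappa>') * (5 + 2 * \<kappa>') \<le> \<kappa> * (1 + \<kappa>) * (5 + 2 * \<kappa>)" using le by (intro mult_mono) auto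
  then have "2 * (C1 + C3) * (1 + \<kappa>') + C1 * (\<kappa>' * (1 + \<kappa>') * (5 + 2 * \<kappa>')) + 4 * C1
      \<le> 2 * (C1 + C3) * (1 + \<kappa>) + C1 * (\<kappa> * (1 + \<kappa>) * (5 + 2 * \<kappa>)) + 4 * C1"
    using le assms by (intro add_mono mult_left_mono) auto
  moreover have "0 \<le> 2 * (C1 + C3) * (1 + \<kappa>') + C1 * (\<kappa>' * (1 + \<kappa>') * (5 + 2 * \<kappa>')) + 4 * C1"
    using le assms by simp
  ultimately have 2: "(2 + \<kappa>') * (2 * (C1 + C3) * (1 + \<kappa>') + C1 * (\<kappa>' * (1 + \<kappa>') * (5 + 2 * \<kappa>')) + 4 * C1)
      \<le> (2 + \<kappa>) * (2 * (C1 + C3) * (1 + \<kappa>) + C1 * (\<kappa> * (1 + \<kappa>) * (5 + 2 * \<kappa>)) + 4 * C1)"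
    using le by (intro mult_mono) auto
  have "32 * C1\<^sup>2 * C2 * C5 * ((2 + \<kappa>') * (1 + \<kappa>')) / \<delta> \<le> 32 * C1\<^sup>2 * C2 * C5 * ((2 + \<kappa>) * (1 + \<kappa>)) / \<delta>"
    using assms by (intro divide_right_mono mult_left_mono 1) auto
  moreover have "512 * C1 ^ 3 * C2\<^sup>2 * C5 * ((2 + \<kappa>') * (2 * (C1 + C3) * (1 + \<kappa>') + C1 * (\<kappa>' * (1 + \<kappa>') * (5 + 2 * \<kappa>')) + 4 * C1))
      \<le> 512 * C1 ^ 3 * C2\<^sup>2 * C5 * ((2 + \<kappa>) * (2 * (C1 + C3) * (1 + \<kappa>) + C1 * (\<kappa> * (1 + \<kappa>) * (5 + 2 * \<kappa>)) + 4 * C1))"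
    using assms by (intro mult_left_mono 2) auto
  ultimately show "gradient_constant C1 C2 C3 C4 C5 n \<delta> \<le> gradient_constant C1 C2 C3 C4 C5 m \<delta>"
    unfolding gradient_constant_def Let_def \<kappa>_def \<kappa>'_def by (simp only: mult.assoc add_le_cancel_right add_mono)
qed

text \<open>The function \<open>d \<bar>\<nabla>u\<bar>\<close>, with \<open>d\<close> the distance to the complement of \<open>Q\<close> in the maximum norm, attains its
maximum at some \<open>x0\<close>.  On the square of radius \<open>d(x0) / 2\<close> around \<open>x0\<close> the distance is at least
\<open>d(x0) / 2\<close>, so \<open>\<bar>\<nabla>u\<bar> \<le> 2 P\<close> with \<open>P = \<bar>\<nabla>u(x0)\<bar>\<close>.  Then \<open>gradient_bound\<close> reads
\<open>P \<le> c / \<rho> + c' \<rho> + c'' \<rho> P\<close>, and \<open>\<rho>\<close> is chosen such that \<open>c'' \<rho> \<le> 1 / 2\<close>.  Since \<open>\<rho>\<close> is comparable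
to \<open>d(x0)\<close> or to a constant, this bounds \<open>d(x0) P\<close>, and \<open>d \<ge> \<delta>\<close> on the small square.\<close>

proposition interior_gradient_estimate:
  fixes A :: "real^2 \<Rightarrow> real^2^2" and u :: "real^2 \<Rightarrow> real" and y :: "real^2" and \<delta> :: real
  defines "Q \<equiv> square y (2 * \<delta>)"
  assumes S: "open S" "C2_on S u" "Q \<subseteq> S" and \<delta>: "\<delta> > 0"
    and pos: "C1 > 0" "C2 > 0" "C3 > 0" "C4 > 0" "C5 > 0" "m > 0"
    and A_cont: "\<And>i j. continuous_on Q (\<lambda>x. A x $ i $ j)"
    and A_le: "\<And>i j x. x \<in> Q \<Longrightarrow> \<bar>A x $ i $ j\<bar> \<le> C1"
    and A_lip: "\<And>i j x z. x \<in> Q \<Longrightarrow> z \<in> Q \<Longrightarrow>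
                  \<bar>A x $ i $ j - A z $ i $ j\<bar> \<le> C1 * (\<Sum>k\<in>UNIV. \<bar>x $ k - z $ k\<bar>)"
    and A_diag: "\<And>i x. x \<in> Q \<Longrightarrow> m \<le> \<bar>A x $ i $ i\<bar>"
    and A_det: "\<And>x. x \<in> Q \<Longrightarrow> det (A x) \<noteq> 0 \<and> inverse \<bar>det (A x)\<bar> \<le> C2"
    and u_le: "\<And>x. x \<in> Q \<Longrightarrow> \<bar>u x\<bar> \<le> C5"
    and ineq: "\<And>i x. x \<in> Q \<Longrightarrow> - (C4 + (C1 + C3) * (\<Sum>k\<in>UNIV. \<bar>partial k u x\<bar>))
                  \<le> (\<Sum>j\<in>UNIV. A x $ i $ j * partial i (partial j u) x)"
    and x: "x \<in> square y \<delta>"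
  shows "norm (grad u x) \<le> gradient_constant C1 C2 C3 C4 C5 m \<delta>"
proof -
  define \<kappa> where "\<kappa> = C1 / m"
  define \<gamma> where "\<gamma> = 2 * (C1 + C3) * (1 + \<kappa>) + C1 * \<kappa> * (1 + \<kappa>) * (5 + 2 * \<kappa>) + 4 * C1"
  have \<kappa>0: "0 < \<kappa>" using pos by (simp add: \<kappa>_def)
  have \<gamma>0: "0 < \<gamma>" unfolding \<gamma>_def by (intro add_pos_pos mult_pos_pos) (use pos \<kappa>0 in auto)
  have \<gamma>_ge: "2 * C1 * (1 + \<kappa>) \<le> \<gamma>"
  proof -
    have "0 \<le> 2 * C3 * (1 + \<kappa>)" "0 \<le> C1 * \<kappa> * (1 + \<kappa>) * (5 + 2 * \<kappa>)" "0 \<le> 4 * C1" using pos \<kappa>0 by simp_all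
    then show ?thesis by (simp add: \<gamma>_def distrib_left distrib_right)
  qed
  define d where "d z = min (2 * \<delta> - \<bar>z $ 1 - y $ 1\<bar>) (2 * \<delta> - \<bar>z $ 2 - y $ 2\<bar>)" for z :: "real^2"
  have d_le: "d z \<le> 2 * \<delta> - \<bar>z $ k - y $ k\<bar>" for z k
    using exhaust_2[of k] by (auto simp: d_def)
  have d_ge: "r \<le> d z" if "z \<in> square y (2 * \<delta> - r)" for z r
    using that by (auto simp: mem_square_iff d_def forall_2)
  have d_nonneg: "0 \<le> d z" if "z \<in> Q" for z using d_ge[of z 0] that by (simp add: Q_def)
  have cont_grad: "continuous_on Q (grad u)"
    unfolding grad_def[abs_def]
    using S by (intro continuous_on_vec_lambda continuous_on_subset[OF _ S(3)]) (auto simp: C2_on_def C1_on_def)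
  have "continuous_on Q (\<lambda>z. d z * norm (grad u z))"
    unfolding d_def by (intro continuous_intros cont_grad)
  moreover have "compact Q" by (simp add: Q_def square_def)
  moreover have "y \<in> Q" using \<delta> by (simp add: Q_def mem_square_iff)
  ultimately obtain x0 where x0: "x0 \<in> Q"
    and max: "\<And>z. z \<in> Q \<Longrightarrow> d z * norm (grad u z) \<le> d x0 * norm (grad u x0)"
    using continuous_attains_sup[of Q "\<lambda>z. d z * norm (grad u z)"] by blast
  define P where "P = norm (grad u x0)"
  define d0 where "d0 = d x0"
  have d0_le: "d0 \<le> 2 * \<delta>" using d_le[of x0 1] by (simp add: d0_def)
  have main: "d0 * P \<le> \<delta> * gradient_constant C1 C2 C3 C4 C5 m \<delta>"
  proof (cases "d0 * P = 0")
    case True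
    have "0 \<le> \<delta> * gradient_constant C1 C2 C3 C4 C5 m \<delta>"
      using gradient_constant_pos[OF pos \<delta>] \<delta> by (intro mult_nonneg_nonneg) auto
    then show ?thesis unfolding True .
  next
    case False
    then have d0: "0 < d0" and P: "0 < P"
      using d_nonneg[OF x0] by (auto simp: d0_def P_def less_le)
    have near: "d0 / 2 \<le> d z \<and> z \<in> Q" if "z \<in> square x0 (d0 / 2)" for z
    proof -
      have "\<bar>z $ k - y $ k\<bar> \<le> 2 * \<delta> - d0 / 2" for k
        using that d_le[of x0 k] unfolding mem_square_iff d0_def by (smt (verit, ccfv_SIG) field_sum_of_halves)
      then have "z \<in> square y (2 * \<delta> - d0 / 2)" by (simp add: mem_square_iff)
      moreover have "square y (2 * \<delta> - d0 / 2) \<subseteq> Q" unfolding Q_def by (rule square_mono) (use d0 in simp)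
      ultimately show ?thesis using d_ge by blast
    qed
    define G where "G = 2 * P"
    define K where "K = C4 + 2 * (C1 + C3) * G"
    have grad_le: "\<bar>partial k u z\<bar> \<le> G" if z: "z \<in> square x0 (d0 / 2)" for k z
    proof -
      have "(d0 / 2) * norm (grad u z) \<le> d z * norm (grad u z)"
        using near[OF z] by (intro mult_right_mono) auto
      also have "\<dots> \<le> d0 * P" using max near[OF z] by (simp add: d0_def P_def)
      finally have "norm (grad u z) \<le> G" using d0 by (simp add: G_def field_simps)
      moreover have "\<bar>grad u z $ k\<bar> \<le> norm (grad u z)" by (rule component_le_norm_cart)
      ultimately show ?thesis by (simp add: grad_def)
    qed
    interpret flux_box S x0 "d0 / 2" A u C1 m C5 G K
    proof
      show "0 \<le> K" unfolding K_def G_def using pos P by (intro add_nonneg_nonneg mult_nonneg_nonneg) auto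
      show "continuous_on (square x0 (d0 / 2)) (\<lambda>x. A x $ i $ j)" for i j
        using near by (intro continuous_on_subset[OF A_cont]) auto
      show "- K \<le> (\<Sum>j\<in>UNIV. A z $ i $ j * partial i (partial j u) z)" if z: "z \<in> square x0 (d0 / 2)" for i z
      proof -
        have "(C1 + C3) * (\<Sum>k\<in>UNIV. \<bar>partial k u z\<bar>) \<le> (C1 + C3) * (\<Sum>k\<in>(UNIV::2 set). G)"
          using pos by (intro mult_left_mono sum_mono grad_le[OF z]) auto
        then show ?thesis using ineq[of z i] near[OF z] by (simp add: K_def algebra_simps)
      qed
    qed (use S pos near grad_le A_le A_lip A_diag u_le in \<open>auto simp: subset_iff\<close>)
    \<comment> \<open>The first entry keeps the segments inside the square of radius \<open>d0 / 2\<close>, the second one makes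
        the coefficient of \<open>P\<close> on the right hand side at most \<open>1 / 2\<close>.\<close>
    define \<rho> where "\<rho> = min (d0 / (2 * (1 + \<kappa>))) (1 / (16 * C1 * C2 * \<gamma>))"
    have \<rho>: "0 < \<rho>" using d0 \<kappa>0 pos \<gamma>0 by (simp add: \<rho>_def)
    have \<rho>1: "\<rho> * (1 + \<kappa>) \<le> d0 / 2"
    proof -
      have "\<rho> * (1 + \<kappa>) \<le> d0 / (2 * (1 + \<kappa>)) * (1 + \<kappa>)"
        using \<kappa>0 by (intro mult_right_mono) (auto simp: \<rho>_def)
      moreover have "d0 / (2 * c) * c = d0 / 2" if "0 < c" for c :: real using that by simp
      ultimately show ?thesis using \<kappa>0 by (metis add_pos_pos zero_less_one)
    qed
    have \<rho>2: "\<rho> * (16 * C1 * C2 * \<gamma>) \<le> 1"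
    proof -
      have "\<rho> * (16 * C1 * C2 * \<gamma>) \<le> 1 / (16 * C1 * C2 * \<gamma>) * (16 * C1 * C2 * \<gamma>)"
        using pos \<gamma>0 by (intro mult_right_mono) (auto simp: \<rho>_def)
      then show ?thesis using pos \<gamma>0 by simp
    qed
    have inv_\<rho>: "d0 / \<rho> \<le> 2 * (1 + \<kappa>) + 32 * C1 * C2 * \<gamma> * \<delta>"
    proof (cases "d0 / (2 * (1 + \<kappa>)) \<le> 1 / (16 * C1 * C2 * \<gamma>)")
      case True
      then have "d0 / \<rho> = 2 * (1 + \<kappa>)" using d0 by (simp add: \<rho>_def)
      then show ?thesis using pos \<gamma>0 \<delta> by simp
    next
      case False
      then have "d0 / \<rho> = 16 * C1 * C2 * \<gamma> * d0" by (simp add: \<rho>_def)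
      also have "\<dots> \<le> 16 * C1 * C2 * \<gamma> * (2 * \<delta>)"
        using d0_le pos \<gamma>0 by (intro mult_left_mono) auto
      finally show ?thesis using \<kappa>0 by simp
    qed
    have C4_term: "4 * C1 * C2 * (\<rho> * (C4 * (1 + \<kappa>))) \<le> C4 / (8 * C1)"
    proof -
      have "(4 * C1 * C2 * (\<rho> * (C4 * (1 + \<kappa>)))) * (8 * C1) = C4 * (\<rho> * (16 * C1 * C2 * (2 * C1 * (1 + \<kappa>))))"
        by (simp add: algebra_simps)
      also have "\<dots> \<le> C4 * (\<rho> * (16 * C1 * C2 * \<gamma>))"
        using pos \<rho> by (intro mult_left_mono \<gamma>_ge) auto
      also have "\<dots> \<le> C4 * 1" using pos by (intro mult_left_mono \<rho>2) auto
      finally show ?thesis using pos by (simp add: pos_le_divide_eq)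
    qed
    have "P \<le> 4 * C1 * C2 * (2 * C1 * C5 * (2 + \<kappa>) / \<rho>
        + \<rho> * (C1 * (K / m + (C1 / m + C1\<^sup>2 / m\<^sup>2) * G * (5 + 2 * \<kappa>)) + K + 4 * C1 * G))"
      unfolding P_def \<kappa>_def using \<rho> \<rho>1 A_det[OF x0]
      by (intro gradient_bound) (auto simp: \<kappa>_def)
    also have "C1 * (K / m + (C1 / m + C1\<^sup>2 / m\<^sup>2) * G * (5 + 2 * \<kappa>)) + K + 4 * C1 * G = C4 * (1 + \<kappa>) + \<gamma> * G"
    proof -
      have "C1 * (K / m) = \<kappa> * K" "C1\<^sup>2 / m\<^sup>2 = \<kappa>\<^sup>2" by (simp_all add: \<kappa>_def power_divide)
      then show ?thesis
        by (simp add: K_def \<gamma>_def algebra_simps power2_eq_square flip: \<kappa>_def)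
    qed
    also have "4 * C1 * C2 * (2 * C1 * C5 * (2 + \<kappa>) / \<rho> + \<rho> * (C4 * (1 + \<kappa>) + \<gamma> * G))
      = 8 * C1\<^sup>2 * C2 * C5 * (2 + \<kappa>) / \<rho> + 4 * C1 * C2 * (\<rho> * (C4 * (1 + \<kappa>)))
        + (\<rho> * (16 * C1 * C2 * \<gamma>)) * (P / 2)"
      by (simp add: G_def algebra_simps power2_eq_square)
    also have "\<dots> \<le> 8 * C1\<^sup>2 * C2 * C5 * (2 + \<kappa>) / \<rho> + C4 / (8 * C1) + 1 * (P / 2)"
      using P by (intro add_mono C4_term mult_right_mono \<rho>2) auto
    finally have "P \<le> 16 * C1\<^sup>2 * C2 * C5 * (2 + \<kappa>) / \<rho> + C4 / (4 * C1)"
      by (simp add: field_simps)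
    then have "d0 * P \<le> d0 * (16 * C1\<^sup>2 * C2 * C5 * (2 + \<kappa>) / \<rho> + C4 / (4 * C1))"
      using d0 by (intro mult_left_mono) auto
    also have "\<dots> = 16 * C1\<^sup>2 * C2 * C5 * (2 + \<kappa>) * (d0 / \<rho>) + d0 * (C4 / (4 * C1))"
    proof -
      have "d0 * (X / \<rho> + Y) = X * (d0 / \<rho>) + d0 * Y" for X Y :: real by (simp add: distrib_left)
      then show ?thesis .
    qed
    also have "\<dots> \<le> 16 * C1\<^sup>2 * C2 * C5 * (2 + \<kappa>) * (2 * (1 + \<kappa>) + 32 * C1 * C2 * \<gamma> * \<delta>) + (2 * \<delta>) * (C4 / (4 * C1))"
      using pos \<kappa>0 by (intro add_mono mult_left_mono mult_right_mono inv_\<rho> d0_le) auto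
    also have "\<dots> = \<delta> * gradient_constant C1 C2 C3 C4 C5 m \<delta>"
    proof -
      define a where "a = 32 * C1\<^sup>2 * C2 * C5 * (2 + \<kappa>) * (1 + \<kappa>)"
      define c where "c = 512 * C1 ^ 3 * C2\<^sup>2 * C5 * (2 + \<kappa>) * \<gamma>"
      have "gradient_constant C1 C2 C3 C4 C5 m \<delta> = a / \<delta> + c + C4 / (2 * C1)"
        unfolding gradient_constant_def Let_def a_def c_def \<gamma>_def \<kappa>_def ..
      then have "\<delta> * gradient_constant C1 C2 C3 C4 C5 m \<delta> = a + c * \<delta> + \<delta> * (C4 / (2 * C1))"
        using \<delta> by (simp add: distrib_left mult.commute)
      moreover have "16 * C1\<^sup>2 * C2 * C5 * (2 + \<kappa>) * (2 * (1 + \<kappa>) + 32 * C1 * C2 * \<gamma> * \<delta>) = a + c * \<delta>"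
        unfolding a_def c_def by algebra
      ultimately show ?thesis by simp
    qed
    finally show ?thesis .
  qed
  have xQ: "x \<in> Q" using square_mono[of \<delta> "2 * \<delta>" y] x \<delta> by (auto simp: Q_def)
  have "\<delta> * norm (grad u x) \<le> d x * norm (grad u x)"
    by (intro mult_right_mono d_ge) (use x in simp_all)
  also have "\<dots> \<le> d0 * P" using max[OF xQ] by (simp add: d0_def P_def)
  also note main
  finally show ?thesis using \<delta> by simp
qed

section \<open>Testing weak derivatives\<close>

lemma continuous_on_imp_loc_integrable:
  assumes "continuous_on S f"
  shows "loc_integrable S f"
  unfolding loc_integrable_def
proof (intro allI impI)
  fix K assume K: "compact K \<and> K \<subseteq> S"
  then have "integrable lborel (\<lambda>x. indicator K x *\<^sub>R f x)"
    by (intro borel_integrable_compact continuous_on_subset[OF assms]) auto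
  then have "integrable lebesgue (\<lambda>x. indicator K x *\<^sub>R f x)"
    by (simp add: integrable_completion borel_measurable_integrable)
  moreover have "K \<in> sets lebesgue" using K by (simp add: lmeasurable_compact fmeasurableD)
  ultimately show "integrable (lebesgue_on K) f"
    by (simp add: integrable_restrict_space)
qed

lemma integrable_times_compactly_supported:
  assumes S: "open S" and f: "loc_integrable S f" and \<psi>: "continuous_on S \<psi>"
    and K: "compact K" "K \<subseteq> S" "\<And>x. x \<notin> K \<Longrightarrow> \<psi> x = 0"
  shows "integrable (lebesgue_on S) (\<lambda>x. f x * \<psi> x)"
proof -
  have Ks: "K \<in> sets lebesgue" using K(1) by (simp add: lmeasurable_compact fmeasurableD)
  have Ss: "S \<in> sets lebesgue" using S by simp
  have cK: "continuous_on K \<psi>" by (rule continuous_on_subset[OF \<psi> K(2)])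
  obtain B where B: "\<And>x. x \<in> K \<Longrightarrow> \<bar>\<psi> x\<bar> \<le> B"
    using compact_imp_bounded[OF compact_continuous_image[OF cK K(1)]]
    by (metis bounded_iff image_eqI real_norm_def)
  have fK: "integrable (lebesgue_on K) f" using f K by (simp add: loc_integrable_def)
  have "integrable (lebesgue_on K) (\<lambda>x. f x * \<psi> x)"
  proof (rule Bochner_Integration.integrable_bound)
    show "integrable (lebesgue_on K) (\<lambda>x. B * f x)" using fK by simp
    show "(\<lambda>x. f x * \<psi> x) \<in> borel_measurable (lebesgue_on K)"
      by (rule borel_measurable_times[OF borel_measurable_integrable[OF fK]
            continuous_imp_measurable_on_sets_lebesgue[OF cK Ks]])
    have "\<bar>f x * \<psi> x\<bar> \<le> \<bar>B * f x\<bar>" if "x \<in> K" for x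
    proof -
      have "\<bar>\<psi> x\<bar> * \<bar>f x\<bar> \<le> \<bar>B\<bar> * \<bar>f x\<bar>" using B[OF that] by (intro mult_right_mono) auto
      then show ?thesis by (simp add: abs_mult mult.commute)
    qed
    then show "AE x in lebesgue_on K. norm (f x * \<psi> x) \<le> norm (B * f x)"
      by (intro AE_I2) simp
  qed
  then have "integrable lebesgue (\<lambda>x. indicator K x *\<^sub>R (f x * \<psi> x))"
    using Ks by (simp add: integrable_restrict_space)
  moreover have "(\<lambda>x. indicator K x *\<^sub>R (f x * \<psi> x)) = (\<lambda>x. indicator S x *\<^sub>R (f x * \<psi> x))"
    using K(2,3) by (auto simp: fun_eq_iff indicator_def)
  ultimately show ?thesis using Ss by (simp add: integrable_restrict_space)
qed

lemma has_derivative_zero_outside: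
  assumes "closed K" "\<And>x. x \<notin> K \<Longrightarrow> f x = (0::real)" "x \<notin> K"
  shows "(f has_derivative (\<lambda>h. 0)) (at x)"
  by (rule has_derivative_transform_within_open[of "\<lambda>x. 0" _ _ _ "- K"]) (use assms in auto)

lemma partial_zero_outside:
  assumes "closed K" "\<And>x. x \<notin> K \<Longrightarrow> f x = 0" "x \<notin> K"
  shows "partial k f x = 0"
  using partial_eqI[OF has_derivative_zero_outside[OF assms]] by simp

lemma C1_on_partial_mult:
  assumes "C1_on S f" "C1_on S g" "x \<in> S"
  shows "(\<lambda>x. f x * g x) differentiable (at x)"
    and "partial k (\<lambda>x. f x * g x) x = f x * partial k g x + partial k f x * g x"
proof -
  note D = has_derivative_mult[OF C1_on_has_derivative[OF assms(1,3)] C1_on_has_derivative[OF assms(2,3)]]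
  show "(\<lambda>x. f x * g x) differentiable (at x)" using D by (rule differentiableI)
  have "(\<Sum>l\<in>UNIV. c l * axis k 1 $ l) = c k" for c :: "2 \<Rightarrow> real"
    by (simp add: axis_def if_distrib[of "(*) _"] cong: if_cong)
  then show "partial k (\<lambda>x. f x * g x) x = f x * partial k g x + partial k f x * g x"
    using partial_eqI[OF D] by simp
qed

lemma test_fun_mult_C1:
  assumes S: "open S" and v: "C1_on S v" and \<phi>: "test_fun S \<phi>"
  shows "test_fun S (\<lambda>x. v x * \<phi> x)"
proof -
  obtain K where K: "compact K" "K \<subseteq> S" "\<And>x. x \<notin> K \<Longrightarrow> \<phi> x = 0" and \<phi>1: "C1_on UNIV \<phi>"
    using \<phi> by (auto simp: test_fun_def)
  have cl: "closed K" by (rule compact_imp_closed[OF K(1)])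
  have \<phi>S: "C1_on S \<phi>" by (rule C1_on_subset[OF \<phi>1]) simp
  have zero: "v x * \<phi> x = 0" if "x \<notin> K" for x using K(3)[OF that] by simp
  have cover: "UNIV = S \<union> - K" using K(2) by auto
  have "C1_on UNIV (\<lambda>x. v x * \<phi> x)"
    unfolding C1_on_def
  proof (intro conjI ballI allI)
    fix x show "(\<lambda>x. v x * \<phi> x) differentiable (at x)"
    proof (cases "x \<in> S")
      case True then show ?thesis by (rule C1_on_partial_mult(1)[OF v \<phi>S])
    next
      case False
      with K(2) have "x \<notin> K" by auto
      from differentiableI[OF has_derivative_zero_outside[OF cl zero this]] show ?thesis by simp
    qed
  next
    fix k
    have "continuous_on S (\<lambda>x. v x * partial k \<phi> x + partial k v x * \<phi> x)"
      using v \<phi>S by (intro continuous_intros C1_on_continuous_on[OF v] C1_on_continuous_on[OF \<phi>S]) (auto simp: C1_on_def)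
    then have "continuous_on S (partial k (\<lambda>x. v x * \<phi> x))"
      by (rule continuous_on_eq) (simp add: C1_on_partial_mult(2)[OF v \<phi>S])
    moreover have "continuous_on (- K) (partial k (\<lambda>x. v x * \<phi> x))"
      by (rule continuous_on_eq[OF continuous_on_const[of _ 0]])
         (simp add: partial_zero_outside[OF cl zero])
    ultimately show "continuous_on UNIV (partial k (\<lambda>x. v x * \<phi> x))"
      unfolding cover using S cl by (intro continuous_on_open_Un) (auto simp: open_Compl)
  qed
  then show ?thesis unfolding test_fun_def using K zero by blast
qed

text \<open>The product rule for \<open>\<partial>\<^sub>i (f v)\<close> in the weak sense: \<open>v \<phi>\<close> is a test function for \<open>f\<close>.\<close>

lemma weak_partial_product_rule:
  assumes S: "open S" and f: "continuous_on S f" "has_weak_partial S i f g"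
    and v: "C1_on S v" and \<phi>: "test_fun S \<phi>"
  shows "(LINT x|lebesgue_on S. f x * v x * partial i \<phi> x)
       = - (LINT x|lebesgue_on S. (g x * v x + f x * partial i v x) * \<phi> x)"
proof -
  obtain K where K: "compact K" "K \<subseteq> S" "\<And>x. x \<notin> K \<Longrightarrow> \<phi> x = 0" and \<phi>1: "C1_on UNIV \<phi>"
    using \<phi> by (auto simp: test_fun_def)
  have \<phi>S: "C1_on S \<phi>" by (rule C1_on_subset[OF \<phi>1]) simp
  have pK: "partial i \<phi> x = 0" if "x \<notin> K" for x
    by (rule partial_zero_outside[OF compact_imp_closed[OF K(1)] K(3) that])
  have cv: "continuous_on S v" and cpv: "continuous_on S (partial i v)"
    and c\<phi>: "continuous_on S \<phi>" and cp\<phi>: "continuous_on S (partial i \<phi>)"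
    using v \<phi>S by (auto simp: C1_on_def intro!: C1_on_continuous_on)
  have lf: "loc_integrable S f" and lg: "loc_integrable S g"
    using f(2) by (auto simp: has_weak_partial_def)
  have I1: "integrable (lebesgue_on S) (\<lambda>x. f x * (v x * partial i \<phi> x))"
    by (rule integrable_times_compactly_supported[OF S lf _ K(1,2)])
       (auto intro!: continuous_intros cv cp\<phi> simp: pK)
  have I2: "integrable (lebesgue_on S) (\<lambda>x. f x * (partial i v x * \<phi> x))"
    by (rule integrable_times_compactly_supported[OF S lf _ K(1,2)])
       (auto intro!: continuous_intros cpv c\<phi> simp: K(3))
  have I3: "integrable (lebesgue_on S) (\<lambda>x. g x * (v x * \<phi> x))"
    by (rule integrable_times_compactly_supported[OF S lg _ K(1,2)])
       (auto intro!: continuous_intros cv c\<phi> simp: K(3))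
  have "(LINT x|lebesgue_on S. f x * (v x * partial i \<phi> x)) + (LINT x|lebesgue_on S. f x * (partial i v x * \<phi> x))
      = (LINT x|lebesgue_on S. f x * (v x * partial i \<phi> x) + f x * (partial i v x * \<phi> x))"
    by (rule Bochner_Integration.integral_add[symmetric, OF I1 I2])
  also have "\<dots> = (LINT x|lebesgue_on S. f x * partial i (\<lambda>x. v x * \<phi> x) x)"
    by (rule Bochner_Integration.integral_cong)
       (simp_all add: C1_on_partial_mult(2)[OF v \<phi>S] distrib_left)
  also have "\<dots> = - (LINT x|lebesgue_on S. g x * (v x * \<phi> x))"
    using f(2) test_fun_mult_C1[OF S v \<phi>] by (simp add: has_weak_partial_def)
  finally have "(LINT x|lebesgue_on S. f x * (v x * partial i \<phi> x))
     = - ((LINT x|lebesgue_on S. g x * (v x * \<phi> x)) + (LINT x|lebesgue_on S. f x * (partial i v x * \<phi> x)))"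
    by simp
  also have "(LINT x|lebesgue_on S. g x * (v x * \<phi> x)) + (LINT x|lebesgue_on S. f x * (partial i v x * \<phi> x))
      = (LINT x|lebesgue_on S. g x * (v x * \<phi> x) + f x * (partial i v x * \<phi> x))"
    by (rule Bochner_Integration.integral_add[symmetric, OF I3 I2])
  finally show ?thesis by (simp add: algebra_simps)
qed

section \<open>Bumps\<close>

lemma DERIV_max0_squared: "((\<lambda>s::real. (max 0 s)\<^sup>2) has_real_derivative 2 * max 0 s) (at s)"
proof -
  consider "s < 0" | "s > 0" | "s = 0" by linarith
  then show ?thesis
  proof cases
    case 1
    have "((\<lambda>s::real. (max 0 s)\<^sup>2) has_real_derivative 0) (at s)"
      by (rule has_field_derivative_transform_within_open[of "\<lambda>s. 0" _ _ "{..<0}"]) (use 1 in auto)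
    then show ?thesis using 1 by simp
  next
    case 2
    have "((\<lambda>s::real. s\<^sup>2) has_real_derivative 2 * s) (at s)" by (auto intro!: derivative_eq_intros)
    then have "((\<lambda>s::real. (max 0 s)\<^sup>2) has_real_derivative 2 * s) (at s)"
      by (rule has_field_derivative_transform_within_open[of _ _ _ "{0<..}"]) (use 2 in auto)
    then show ?thesis using 2 by simp
  next
    case 3
    have "(\<lambda>h::real. ((max 0 (0 + h))\<^sup>2 - (max 0 0)\<^sup>2) / h) \<midarrow>0\<rightarrow> 0"
    proof (rule Lim_null_comparison)
      show "\<forall>\<^sub>F h::real in at 0. norm (((max 0 (0 + h))\<^sup>2 - (max 0 0)\<^sup>2) / h) \<le> \<bar>h\<bar>"
        by (rule always_eventually) (auto simp: max_def power2_eq_square)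
      show "((\<lambda>h::real. \<bar>h\<bar>) \<longlongrightarrow> 0) (at 0)" by (rule tendsto_rabs_zero[OF tendsto_ident_at])
    qed
    then show ?thesis unfolding 3 DERIV_def by simp
  qed
qed

text \<open>Piecewise polynomial and of class \<open>C\<^sup>1\<close>, which is all that test functions require; positive
exactly on \<open>\<bar>t\<bar> < r\<close> for \<open>r > 0\<close>.\<close>

definition bump :: "real \<Rightarrow> real \<Rightarrow> real" where
  "bump r t = (max 0 (r\<^sup>2 - t\<^sup>2))\<^sup>2"

lemma bump_nonneg: "0 \<le> bump r t"
  by (simp add: bump_def)

lemma bump_eq_0: "0 \<le> r \<Longrightarrow> r \<le> \<bar>t\<bar> \<Longrightarrow> bump r t = 0"
  using power_mono[of r "\<bar>t\<bar>" 2] by (simp add: bump_def)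

lemma bump_pos: "\<bar>t\<bar> < r \<Longrightarrow> 0 < bump r t"
  using power_strict_mono[of "\<bar>t\<bar>" r 2] by (simp add: bump_def)

lemma DERIV_bump: "(bump r has_real_derivative - 4 * t * max 0 (r\<^sup>2 - t\<^sup>2)) (at t)"
proof -
  have "((\<lambda>t. r\<^sup>2 - t\<^sup>2) has_real_derivative - 2 * t) (at t)"
    by (auto intro!: derivative_eq_intros)
  from DERIV_chain2[OF DERIV_max0_squared this] show ?thesis
    unfolding bump_def[abs_def] by (rule DERIV_cong) simp
qed

lemma DERIV_bump_shift:
  "((\<lambda>t. bump r (t - c)) has_real_derivative - 4 * (t - c) * max 0 (r\<^sup>2 - (t - c)\<^sup>2)) (at t)"
proof -
  have "((\<lambda>t. t - c) has_real_derivative 1) (at t)" by (auto intro!: derivative_eq_intros)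
  from DERIV_chain2[OF DERIV_bump this] show ?thesis by simp
qed

lemma continuous_on_bump: "continuous_on T (bump r)"
  unfolding bump_def[abs_def] by (intro continuous_intros)

lemma C1_on_separated_product:
  fixes F F' B B' :: "real \<Rightarrow> real" and k l :: 2
  assumes kl: "k \<noteq> l"
    and F: "\<And>t. (F has_real_derivative F' t) (at t)" "continuous_on UNIV F'"
    and B: "\<And>t. (B has_real_derivative B' t) (at t)" "continuous_on UNIV B'"
  shows "C1_on UNIV (\<lambda>z. F (z $ k) * B (z $ l))"
    and "partial k (\<lambda>z. F (z $ k) * B (z $ l)) z = F' (z $ k) * B (z $ l)"
proof -
  let ?\<phi> = "\<lambda>z::real^2. F (z $ k) * B (z $ l)"
  have D: "(?\<phi> has_derivative (\<lambda>h. F (z $ k) * (h $ l * B' (z $ l)) + h $ k * F' (z $ k) * B (z $ l))) (at z)" for z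
  proof -
    have "((\<lambda>z. F (z $ k)) has_derivative (\<lambda>h. h $ k * F' (z $ k))) (at z)"
      by (rule DERIV_compose_FDERIV[OF F(1)])
         (rule bounded_linear_imp_has_derivative[OF bounded_linear_vec_nth])
    moreover have "((\<lambda>z. B (z $ l)) has_derivative (\<lambda>h. h $ l * B' (z $ l))) (at z)"
      by (rule DERIV_compose_FDERIV[OF B(1)])
         (rule bounded_linear_imp_has_derivative[OF bounded_linear_vec_nth])
    ultimately show ?thesis by (rule has_derivative_mult)
  qed
  have p: "partial j ?\<phi> z = (if j = k then F' (z $ k) * B (z $ l) else F (z $ k) * B' (z $ l))" for j z
    unfolding partial_eqI[OF D] using kl UNIV_eq_2[OF kl] by (auto simp: axis_def)
  show "partial k ?\<phi> z = F' (z $ k) * B (z $ l)" by (simp add: p)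
  have cont: "continuous_on UNIV F" "continuous_on UNIV B"
    by (auto intro!: continuous_at_imp_continuous_on DERIV_isCont[OF F(1)] DERIV_isCont[OF B(1)])
  have coord: "continuous_on UNIV (\<lambda>z::real^2. f (z $ j))" if "continuous_on UNIV f" for f :: "real \<Rightarrow> real" and j
    by (rule continuous_on_compose2[OF that]) (auto intro!: continuous_intros)
  show "C1_on UNIV ?\<phi>"
    unfolding C1_on_def
  proof (intro conjI ballI allI differentiableI[OF D])
    fix j show "continuous_on UNIV (partial j ?\<phi>)"
      unfolding p[abs_def] by (cases "j = k") (auto intro!: continuous_intros coord cont F(2) B(2))
  qed
qed

section \<open>The differential inequalities at every point\<close>

text \<open>If \<open>g(x) < 0\<close>, then \<open>g < 0\<close> on a small square around \<open>x\<close>, and a product of two bumps supported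
there gives a negative integral.\<close>

lemma nonneg_if_test_integrals_nonneg:
  assumes S: "open S" and g: "continuous_on S g"
    and nn: "\<And>\<phi>. test_fun S \<phi> \<Longrightarrow> (\<And>x. 0 \<le> \<phi> x) \<Longrightarrow> 0 \<le> (LINT x|lebesgue_on S. g x * \<phi> x)"
    and x: "x \<in> S"
  shows "0 \<le> g x"
proof (rule ccontr)
  assume neg: "\<not> 0 \<le> g x"
  define N where "N = {z \<in> S. g z < 0}"
  have N: "open N" "x \<in> N"
    using neg x continuous_on_open_vimage[OF S, of g] g
    by (auto simp: N_def vimage_def Int_def conj_commute dest!: spec[of _ "{..<0}"])
  obtain e where e: "e > 0" "cball x e \<subseteq> N" using N open_contains_cball by blast
  define r where "r = e / 2"
  have r: "0 < r" using e by (simp add: r_def)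
  define \<phi> :: "real^2 \<Rightarrow> real" where "\<phi> z = bump r (z $ 1 - x $ 1) * bump r (z $ 2 - x $ 2)" for z
  have sq: "square x r \<subseteq> N"
  proof
    fix z assume z: "z \<in> square x r"
    have "norm (z - x) \<le> \<bar>z $ 1 - x $ 1\<bar> + \<bar>z $ 2 - x $ 2\<bar>"
      using norm_le_l1_cart[of "z - x"] by (simp add: sum_2)
    also have "\<dots> \<le> e" using z by (simp add: mem_square_iff forall_2 r_def)
    finally show "z \<in> N" using e(2) by (auto simp: dist_norm norm_minus_commute)
  qed
  have out: "\<phi> z = 0" if "z \<notin> square x r" for z
  proof -
    have "r < \<bar>z $ 1 - x $ 1\<bar> \<or> r < \<bar>z $ 2 - x $ 2\<bar>" using that by (auto simp: mem_square_iff forall_2)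
    then show ?thesis using r bump_eq_0[of r] by (auto simp: \<phi>_def)
  qed
  have db: "((\<lambda>t. bump r (t - c)) has_real_derivative - 4 * (t - c) * max 0 (r\<^sup>2 - (t - c)\<^sup>2)) (at t)" for c t
    by (rule DERIV_bump_shift)
  have cb: "continuous_on UNIV (\<lambda>t. - 4 * (t - c) * max 0 (r\<^sup>2 - (t - c)\<^sup>2))" for c :: real
    by (intro continuous_intros)
  have C1: "C1_on UNIV \<phi>"
    unfolding \<phi>_def[abs_def]
    by (rule C1_on_separated_product(1)[OF _ db cb db cb, of 1 2 "x $ 1" "x $ 2"]) simp
  have cpt: "compact (square x r)" by (simp add: square_def)
  have NS: "N \<subseteq> S" by (auto simp: N_def)
  have test: "test_fun S \<phi>"
    unfolding test_fun_def using C1 cpt sq NS out by blast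
  have \<phi>0: "0 \<le> \<phi> z" for z by (simp add: \<phi>_def bump_nonneg)
  have le: "g z * \<phi> z \<le> 0" for z
  proof (cases "z \<in> square x r")
    case True
    then have "g z < 0" using sq by (auto simp: N_def)
    then show ?thesis using \<phi>0[of z] by (simp add: mult_nonpos_nonneg)
  qed (simp add: out)
  have "continuous_on S \<phi>" by (rule continuous_on_subset[OF C1_on_continuous_on[OF C1]]) simp
  then have int: "integrable (lebesgue_on S) (\<lambda>z. g z * \<phi> z)"
    using sq NS out
    by (intro integrable_times_compactly_supported[OF S continuous_on_imp_loc_integrable[OF g] _ cpt]) auto
  have "(LINT z|lebesgue_on S. - (g z * \<phi> z)) = 0"
  proof (rule antisym)
    show "(LINT z|lebesgue_on S. - (g z * \<phi> z)) \<le> 0" using nn[OF test \<phi>0] by simp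
    show "0 \<le> (LINT z|lebesgue_on S. - (g z * \<phi> z))" using le by (intro Bochner_Integration.integral_nonneg) simp
  qed
  then have "AE z in lebesgue_on S. - (g z * \<phi> z) = 0"
    using int le by (subst (asm) integral_nonneg_eq_0_iff_AE) auto
  then have ae: "AE z in lebesgue. z \<in> S \<longrightarrow> g z * \<phi> z = 0"
    using S by (simp add: AE_restrict_space_iff)
  have nz: "z \<in> S \<and> g z * \<phi> z \<noteq> 0" if "z \<in> box (x - vec r) (x + vec r)" for z
  proof -
    have "\<bar>z $ k - x $ k\<bar> < r" for k using that by (simp add: mem_box_cart abs_less_iff) (smt (verit))
    then have "0 < \<phi> z" "z \<in> square x r" by (auto simp: \<phi>_def bump_pos mem_square_iff less_imp_le)
    then show ?thesis using sq NS by (auto simp: N_def)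
  qed
  have "AE z in lebesgue. z \<notin> box (x - vec r) (x + vec r)"
    using ae by eventually_elim (use nz in blast)
  then have "negligible (box (x - vec r) (x + vec r))"
    unfolding negligible_iff_null_sets by (subst AE_iff_null_sets) simp_all
  moreover have "x \<in> box (x - vec r) (x + vec r)" using r by (simp add: mem_box_cart)
  ultimately show False using open_not_negligible[OF open_box] by blast
qed

text \<open>By the product rule, \<open>h j\<close>, when tested, is \<open>a\<^sub>j \<partial>\<^sub>i \<partial>\<^sub>j u\<close> plus the weak derivative of \<open>a\<^sub>j\<close> times \<open>\<partial>\<^sub>j u\<close>.  The latter is
only known almost everywhere, but it is bounded by \<open>C1 \<bar>\<partial>\<^sub>j u\<bar>\<close>; what remains is
an inequality between continuous functions, valid in the weak sense and therefore everywhere.\<close>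

lemma pointwise_differential_inequality:
  fixes a c :: "2 \<Rightarrow> real^2 \<Rightarrow> real"
  assumes S: "open S" and u: "C2_on S u" and nonneg: "0 \<le> C1" "0 \<le> C3"
    and a: "\<And>j. continuous_on S (a j)" "\<And>j. weak_grad_le S (a j) C1"
    and c: "\<And>j. continuous_on S (c j)" "\<And>j x. x \<in> S \<Longrightarrow> \<bar>c j x\<bar> \<le> C3"
    and h: "\<And>j. has_weak_partial S i (\<lambda>x. a j x * partial j u x) (h j)"
    and ineq: "AE x in lebesgue_on S. - (\<Sum>j\<in>UNIV. h j x + c j x * partial j u x) \<le> C4"
    and x: "x \<in> S"
  shows "- (C4 + (C1 + C3) * (\<Sum>j\<in>UNIV. \<bar>partial j u x\<bar>)) \<le> (\<Sum>j\<in>UNIV. a j x * partial i (partial j u) x)"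
proof -
  let ?g = "\<lambda>x. C4 + (\<Sum>j\<in>UNIV. (C1 + C3) * \<bar>partial j u x\<bar> + a j x * partial i (partial j u) x)"
  have C1pu: "C1_on S (partial j u)" for j using u by (auto simp: C2_on_def)
  have cu: "continuous_on S (partial j u)" for j by (rule C1_on_continuous_on[OF C1pu])
  have cuu: "continuous_on S (partial i (partial j u))" for j using C1pu by (auto simp: C1_on_def)
  have "\<exists>G. has_weak_grad S (a j) G \<and> (AE x in lebesgue_on S. norm (G x) \<le> C1)" for j
    using a(2) by (simp add: weak_grad_le_def)
  then obtain G where G: "\<And>j. has_weak_grad S (a j) (G j)" "\<And>j. AE x in lebesgue_on S. norm (G j x) \<le> C1"
    by metis
  have Gi: "has_weak_partial S i (a j) (\<lambda>x. G j x $ i)" for j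
    using G(1) by (auto simp: has_weak_grad_def)
  have "0 \<le> ?g x"
  proof (rule nonneg_if_test_integrals_nonneg[OF S _ _ x])
    show "continuous_on S ?g" by (intro continuous_intros cu cuu a(1))
    fix \<phi> assume \<phi>: "test_fun S \<phi>" and \<phi>0: "\<And>x. 0 \<le> \<phi> x"
    obtain K where K: "compact K" "K \<subseteq> S" "\<And>x. x \<notin> K \<Longrightarrow> \<phi> x = 0" and \<phi>1: "C1_on UNIV \<phi>"
      using \<phi> by (auto simp: test_fun_def)
    have c\<phi>: "continuous_on S \<phi>" by (rule continuous_on_subset[OF C1_on_continuous_on[OF \<phi>1]]) simp
    have I: "integrable (lebesgue_on S) (\<lambda>x. f x * \<phi> x)" if "loc_integrable S f" for f
      by (rule integrable_times_compactly_supported[OF S that c\<phi> K])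
    have Ic: "integrable (lebesgue_on S) (\<lambda>x. f x * \<phi> x)" if "continuous_on S f" for f
      by (rule I[OF continuous_on_imp_loc_integrable[OF that]])
    have Ih: "integrable (lebesgue_on S) (\<lambda>x. h j x * \<phi> x)" for j
      using h by (intro I) (simp add: has_weak_partial_def)
    have IG: "integrable (lebesgue_on S) (\<lambda>x. (G j x $ i * partial j u x) * \<phi> x)" for j
    proof -
      have "integrable (lebesgue_on S) (\<lambda>x. G j x $ i * (partial j u x * \<phi> x))"
        using Gi[of j] K(3)
        by (intro integrable_times_compactly_supported[OF S _ _ K(1,2)] continuous_on_mult cu c\<phi>)
           (auto simp: has_weak_partial_def)
      then show ?thesis by (simp add: mult.assoc)
    qed
    have Ia: "integrable (lebesgue_on S) (\<lambda>x. (a j x * partial i (partial j u) x) * \<phi> x)" for j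
      by (intro Ic continuous_intros a(1) cuu)
    have Ib: "integrable (lebesgue_on S) (\<lambda>x. (c j x * partial j u x) * \<phi> x)" for j
      by (intro Ic continuous_intros c(1) cu)
    have IC: "integrable (lebesgue_on S) (\<lambda>x. C4 * \<phi> x)" by (intro Ic continuous_intros)
    have IGa: "integrable (lebesgue_on S) (\<lambda>x. (G j x $ i * partial j u x + a j x * partial i (partial j u) x) * \<phi> x)" for j
      using Bochner_Integration.integrable_add[OF IG Ia] by (simp add: distrib_right)
    have h_eq: "(LINT x|lebesgue_on S. h j x * \<phi> x)
        = (LINT x|lebesgue_on S. (G j x $ i * partial j u x + a j x * partial i (partial j u) x) * \<phi> x)" for j
    proof -
      have "(LINT x|lebesgue_on S. a j x * partial j u x * partial i \<phi> x) = - (LINT x|lebesgue_on S. h j x * \<phi> x)"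
        using h \<phi> by (simp add: has_weak_partial_def)
      then show ?thesis using weak_partial_product_rule[OF S a(1) Gi C1pu \<phi>, of j] by simp
    qed
    have "0 \<le> (LINT x|lebesgue_on S. C4 * \<phi> x + (\<Sum>j\<in>UNIV. h j x * \<phi> x + (c j x * partial j u x) * \<phi> x))"
    proof (rule Bochner_Integration.integral_nonneg_AE)
      show "AE x in lebesgue_on S. 0 \<le> C4 * \<phi> x + (\<Sum>j\<in>UNIV. h j x * \<phi> x + (c j x * partial j u x) * \<phi> x)"
        using ineq
      proof eventually_elim
        case (elim x)
        then have "0 \<le> (C4 + (\<Sum>j\<in>UNIV. h j x + c j x * partial j u x)) * \<phi> x"
          using \<phi>0[of x] by (intro mult_nonneg_nonneg) auto
        then show ?case by (simp add: distrib_right sum_distrib_right)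
      qed
    qed
    also have "\<dots> = (LINT x|lebesgue_on S. C4 * \<phi> x) + (\<Sum>j\<in>UNIV. (LINT x|lebesgue_on S. h j x * \<phi> x)
         + (LINT x|lebesgue_on S. (c j x * partial j u x) * \<phi> x))"
      using IC Ih Ib by simp
    also have "\<dots> = (LINT x|lebesgue_on S. C4 * \<phi> x + (\<Sum>j\<in>UNIV.
           (G j x $ i * partial j u x + a j x * partial i (partial j u) x) * \<phi> x + (c j x * partial j u x) * \<phi> x))"
      unfolding h_eq using IC IGa Ib by simp
    also have "\<dots> \<le> (LINT x|lebesgue_on S. ?g x * \<phi> x)"
    proof (rule integral_mono_AE)
      show "integrable (lebesgue_on S) (\<lambda>x. C4 * \<phi> x + (\<Sum>j\<in>UNIV.
           (G j x $ i * partial j u x + a j x * partial i (partial j u) x) * \<phi> x + (c j x * partial j u x) * \<phi> x))"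
        by (intro Bochner_Integration.integrable_add Bochner_Integration.integrable_sum IC IGa Ib)
      show "integrable (lebesgue_on S) (\<lambda>x. ?g x * \<phi> x)" by (intro Ic continuous_intros cu cuu a(1))
      have "AE x in lebesgue_on S. \<forall>j\<in>UNIV. norm (G j x) \<le> C1"
        using G(2) by (intro AE_finite_allI) auto
      moreover have "AE x in lebesgue_on S. x \<in> S" by (rule AE_I2) simp
      ultimately show "AE x in lebesgue_on S. C4 * \<phi> x + (\<Sum>j\<in>UNIV.
           (G j x $ i * partial j u x + a j x * partial i (partial j u) x) * \<phi> x + (c j x * partial j u x) * \<phi> x)
           \<le> ?g x * \<phi> x"
      proof eventually_elim
        case (elim x)
        have "C4 + (\<Sum>j\<in>UNIV. (G j x $ i * partial j u x + a j x * partial i (partial j u) x) + c j x * partial j u x) \<le> ?g x"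
        proof (intro add_left_mono sum_mono)
          fix j
          have "\<bar>G j x $ i\<bar> \<le> C1" using elim(1) component_le_norm_cart[of "G j x" i] by (meson UNIV_I order_trans)
          then have "\<bar>G j x $ i * partial j u x\<bar> \<le> C1 * \<bar>partial j u x\<bar>"
            unfolding abs_mult by (intro mult_right_mono) auto
          moreover have "\<bar>c j x * partial j u x\<bar> \<le> C3 * \<bar>partial j u x\<bar>"
            unfolding abs_mult using c(2)[OF elim(2)] by (intro mult_right_mono) auto
          ultimately show "(G j x $ i * partial j u x + a j x * partial i (partial j u) x) + c j x * partial j u x
              \<le> (C1 + C3) * \<bar>partial j u x\<bar> + a j x * partial i (partial j u) x"
            unfolding distrib_right by linarith
        qed
        then have "(C4 + (\<Sum>j\<in>UNIV. (G j x $ i * partial j u x + a j x * partial i (partial j u) x) + c j x * partial j u x)) * \<phi> x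
            \<le> ?g x * \<phi> x"
          using \<phi>0 by (intro mult_right_mono)
        then show ?case by (simp only: distrib_right sum_distrib_right)
      qed
    qed
    finally show "0 \<le> (LINT x|lebesgue_on S. ?g x * \<phi> x)" .
  qed
  then show ?thesis by (simp add: sum.distrib sum_distrib_left)
qed

section \<open>Bounded weak derivatives make a function Lipschitz\<close>

text \<open>A bump, smeared over a window of length \<open>t\<close>, has the difference of the bumps at the ends of
the window as its derivative.\<close>

lemma DERIV_bump_window:
  assumes t: "0 \<le> t"
  shows "((\<lambda>\<tau>. integral {0..t} (\<lambda>s. bump r (\<tau> - c - s))) has_real_derivative
           bump r (\<tau> - c) - bump r (\<tau> - c - t)) (at \<tau>)"
proof -
  let ?d = "\<lambda>q. - 4 * q * max 0 (r\<^sup>2 - q\<^sup>2)"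
  have "((\<lambda>\<tau>. integral (cbox 0 t) (\<lambda>s. bump r (\<tau> - c - s))) has_real_derivative
           integral (cbox 0 t) (\<lambda>s. ?d (\<tau> - c - s))) (at \<tau> within UNIV)"
  proof (rule leibniz_rule_field_derivative)
    fix \<tau> s :: real
    show "((\<lambda>\<tau>. bump r (\<tau> - c - s)) has_real_derivative ?d (\<tau> - c - s)) (at \<tau> within UNIV)"
      using DERIV_bump_shift[of r "c + s" \<tau>] by (simp add: diff_diff_eq)
    show "(\<lambda>s. bump r (\<tau> - c - s)) integrable_on cbox 0 t"
      by (intro integrable_continuous continuous_on_compose2[OF continuous_on_bump] continuous_intros) auto
    show "continuous_on (UNIV \<times> cbox 0 t) (\<lambda>(\<tau>, s). ?d (\<tau> - c - s))"
      unfolding split_beta by (intro continuous_intros)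
  qed auto
  moreover have "((\<lambda>s. ?d (\<tau> - c - s)) has_integral (- bump r (\<tau> - c - t)) - (- bump r (\<tau> - c - 0))) {0..t}"
  proof (rule fundamental_theorem_of_calculus[OF t])
    fix s
    have "((\<lambda>s. \<tau> - c - s) has_real_derivative - 1) (at s within {0..t})" by (auto intro!: derivative_eq_intros)
    from DERIV_chain2[OF DERIV_bump this]
    have "((\<lambda>s. - bump r (\<tau> - c - s)) has_real_derivative ?d (\<tau> - c - s)) (at s within {0..t})"
      by (auto intro!: derivative_eq_intros)
    then show "((\<lambda>s. - bump r (\<tau> - c - s)) has_vector_derivative ?d (\<tau> - c - s)) (at s within {0..t})"
      by (simp add: has_real_derivative_iff_has_vector_derivative)
  qed
  ultimately show ?thesis by (simp add: integral_unique)
qed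

text \<open>Take a small bump \<open>\<eta>\<close> around \<open>x\<close> and smear it along the segment: \<open>\<psi>(z) = \<integral>\<^sub>0\<^sup>t \<eta>(z - s e\<^sub>k) ds\<close>.  Then
\<open>\<partial>\<^sub>k \<psi> = \<eta> - \<eta>(\<cdot> - t e\<^sub>k)\<close>, so that \<open>\<integral> f \<partial>\<^sub>k \<psi>\<close> is nearly \<open>\<integral>\<eta>\<close> times the increment of \<open>f\<close>, up to its
sign.  As \<open>\<psi> \<ge> 0\<close>, the same integral is at most \<open>C \<integral>\<psi> = C t \<integral>\<eta>\<close> in absolute value, by Fubini.\<close>

lemma weak_partial_bound_imp_Lipschitz_along_axis:
  fixes f :: "real^2 \<Rightarrow> real" and k :: 2
  assumes S: "open S" and f: "continuous_on S f" "has_weak_partial S k f g"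
    and g: "AE x in lebesgue_on S. \<bar>g x\<bar> \<le> C" and t: "0 \<le> t"
    and seg: "\<And>s. s \<in> {0..t} \<Longrightarrow> x + s *\<^sub>R axis k 1 \<in> S"
  shows "\<bar>f (x + t *\<^sub>R axis k 1) - f x\<bar> \<le> C * t"
proof (rule field_le_epsilon)
  fix e :: real assume e: "0 < e"
  obtain l where kl: "k \<noteq> l" using exhaust_2[of k] by (metis zero_neq_one)
  let ?e = "axis k 1 :: real^2"
  let ?y = "x + t *\<^sub>R ?e"
  have "compact ((\<lambda>s. x + s *\<^sub>R ?e) ` {0..t})"
    by (intro compact_continuous_image continuous_intros) simp
  moreover have "(\<lambda>s. x + s *\<^sub>R ?e) ` {0..t} \<subseteq> S" using seg by auto
  ultimately obtain d where d: "0 < d" "(\<Union>p\<in>(\<lambda>s. x + s *\<^sub>R ?e) ` {0..t}. cball p d) \<subseteq> S"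
    by (rule compact_subset_open_imp_cball_epsilon_subset[OF _ S])
  have near: "\<exists>d'>0. \<forall>z\<in>cball p d'. \<bar>f z - f p\<bar> \<le> e / 2" if "p \<in> S" for p
  proof -
    have "\<exists>d1>0. \<forall>z\<in>S. dist z p < d1 \<longrightarrow> dist (f z) (f p) < e / 2"
      by (rule f(1)[unfolded continuous_on_iff, rule_format, OF \<open>p \<in> S\<close>]) (use e in simp)
    then obtain d1 where d1: "0 < d1" "\<forall>z\<in>S. dist z p < d1 \<longrightarrow> dist (f z) (f p) < e / 2" by (elim exE conjE)
    obtain d2 where d2: "0 < d2" "cball p d2 \<subseteq> S" using S \<open>p \<in> S\<close> unfolding open_contains_cball by meson
    have "\<bar>f z - f p\<bar> \<le> e / 2" if "z \<in> cball p (min (d1 / 2) d2)" for z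
    proof -
      have "dist p z \<le> d1 / 2" "z \<in> cball p d2" using that by auto
      then have "z \<in> S" "dist z p < d1"
        using d1(1) d2(2) by (auto simp: dist_commute)
      then show ?thesis
        using d1(2) by (auto simp: dist_real_def)
    qed
    moreover have "0 < min (d1 / 2) d2" using d1(1) d2(1) by simp
    ultimately show ?thesis by blast
  qed
  have xS: "x \<in> S" "?y \<in> S" using seg[of 0] seg[of t] t by auto
  obtain d1 where d1: "0 < d1" "\<forall>z\<in>cball x d1. \<bar>f z - f x\<bar> \<le> e / 2" using near[OF xS(1)] by blast
  obtain d2 where d2: "0 < d2" "\<forall>z\<in>cball ?y d2. \<bar>f z - f ?y\<bar> \<le> e / 2" using near[OF xS(2)] by blast
  define r where "r = min d (min d1 d2) / 2"
  have r: "0 < r" "2 * r \<le> d" "2 * r \<le> d1" "2 * r \<le> d2" using d d1 d2 by (auto simp: r_def)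
  have sq_cball: "square p r \<subseteq> cball p (2 * r)" for p
  proof
    fix z assume z: "z \<in> square p r"
    have "norm (z - p) \<le> (\<Sum>i\<in>UNIV. \<bar>(z - p) $ i\<bar>)" by (rule norm_le_l1_cart)
    also have "\<dots> \<le> 2 * r" using z by (simp add: sum_2 mem_square_iff forall_2)
    finally show "z \<in> cball p (2 * r)" by (simp add: dist_norm norm_minus_commute)
  qed
  define \<eta> where "\<eta> z = bump r (z $ k - x $ k) * bump r (z $ l - x $ l)" for z :: "real^2"
  define F where "F \<tau> = integral {0..t} (\<lambda>s. bump r (\<tau> - x $ k - s))" for \<tau>
  define \<psi> where "\<psi> z = F (z $ k) * bump r (z $ l - x $ l)" for z :: "real^2"
  define K where "K = cbox (x - vec r) (x + vec r + t *\<^sub>R ?e)"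
  define sh where "sh s = x + s *\<^sub>R ?e" for s
  have sh: "sh s $ k = x $ k + s" "sh s $ l = x $ l" for s using kl by (auto simp: sh_def axis_def)
  have all2: "(\<forall>i. P i) \<longleftrightarrow> P k \<and> P l" for P using UNIV_eq_2[OF kl] by (metis UNIV_I insert_iff empty_iff)
  have memK: "z \<in> K \<longleftrightarrow> - r \<le> z $ k - x $ k \<and> z $ k - x $ k \<le> r + t \<and> \<bar>z $ l - x $ l\<bar> \<le> r" for z
    using kl unfolding K_def mem_box_cart all2 by (auto simp: axis_def)
  have memsq: "z \<in> square (sh s) r \<longleftrightarrow> \<bar>z $ k - x $ k - s\<bar> \<le> r \<and> \<bar>z $ l - x $ l\<bar> \<le> r" for z s
    unfolding mem_square_iff all2 sh by (simp add: algebra_simps)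
  have KS: "K \<subseteq> S"
  proof
    fix z assume z: "z \<in> K"
    define s where "s = max 0 (min t (z $ k - x $ k))"
    have "s \<in> {0..t}" using t by (auto simp: s_def)
    moreover have "z \<in> square (sh s) r" using z t r(1) unfolding memK memsq by (auto simp: s_def max_def min_def)
    ultimately show "z \<in> S" using sq_cball[of "sh s"] r(2) d(2) by (force simp: sh_def)
  qed
  have sqK: "square (sh s) r \<subseteq> K" if "s \<in> {0..t}" for s
    using that by (auto simp: memK memsq)
  have K: "compact K" by (simp add: K_def)
  have \<eta>_shift: "\<eta> (z - s *\<^sub>R ?e) = bump r (z $ k - x $ k - s) * bump r (z $ l - x $ l)" for z s
    using kl by (simp add: \<eta>_def axis_def algebra_simps)
  have \<eta>_out: "\<eta> (z - s *\<^sub>R ?e) = 0" if "z \<notin> square (sh s) r" for z s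
    using that bump_eq_0[of r] r(1) unfolding memsq \<eta>_shift by (auto simp: not_le less_imp_le)
  have \<eta>_nonneg: "0 \<le> \<eta> z" for z by (simp add: \<eta>_def bump_nonneg)
  have \<eta>_cont: "continuous_on T \<eta>" for T
    unfolding \<eta>_def by (intro continuous_intros continuous_on_compose2[OF continuous_on_bump[of UNIV]]) auto
  have \<psi>_eq: "\<psi> z = integral {0..t} (\<lambda>s. \<eta> (z - s *\<^sub>R ?e))" for z
    unfolding \<psi>_def F_def \<eta>_shift by (rule integral_mult_left[symmetric])
  have F_DERIV: "(F has_real_derivative bump r (\<tau> - x $ k) - bump r (\<tau> - x $ k - t)) (at \<tau>)" for \<tau>
    unfolding F_def[abs_def] by (rule DERIV_bump_window[OF t])
  have F'_cont: "continuous_on UNIV (\<lambda>\<tau>. bump r (\<tau> - x $ k) - bump r (\<tau> - x $ k - t))"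
    by (intro continuous_intros continuous_on_compose2[OF continuous_on_bump[of UNIV]]) auto
  have B'_cont: "continuous_on UNIV (\<lambda>t. - 4 * (t - x $ l) * max 0 (r\<^sup>2 - (t - x $ l)\<^sup>2))"
    by (intro continuous_intros)
  note sep = C1_on_separated_product[OF kl F_DERIV F'_cont DERIV_bump_shift[of r "x $ l"] B'_cont]
  have \<psi>_C1: "C1_on UNIV \<psi>" unfolding \<psi>_def[abs_def] by (rule sep(1))
  have \<psi>_partial: "partial k \<psi> z = \<eta> z - \<eta> (z - t *\<^sub>R ?e)" for z
    unfolding \<psi>_def[abs_def] sep(2) \<eta>_shift by (simp add: \<eta>_def left_diff_distrib)
  have \<psi>_nonneg: "0 \<le> \<psi> z" for z
    unfolding \<psi>_eq by (intro integral_nonneg integrable_continuous_real continuous_on_compose2[OF \<eta>_cont[of UNIV]]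
        continuous_intros \<eta>_nonneg) auto
  have \<psi>_out: "\<psi> z = 0" if "z \<notin> K" for z
  proof -
    have "integral {0..t} (\<lambda>s. \<eta> (z - s *\<^sub>R ?e)) = integral {0..t} (\<lambda>s. 0)"
      using that sqK by (intro integral_cong \<eta>_out) auto
    then show ?thesis by (simp add: \<psi>_eq)
  qed
  have test: "test_fun S \<psi>" unfolding test_fun_def using \<psi>_C1 K KS \<psi>_out by blast
  have \<psi>_cont: "continuous_on T \<psi>" for T by (rule continuous_on_subset[OF C1_on_continuous_on[OF \<psi>_C1]]) simp
  define I where "I = integral (square x r) \<eta>"
  have sq0: "square x r = cbox (x - vec r) (x + vec r)" by (simp add: square_def)
  have I_has: "(\<eta> has_integral I) (square x r)"
    unfolding I_def sq0 by (intro integrable_integral integrable_continuous \<eta>_cont)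
  have I_shift: "((\<lambda>z. \<eta> (z - s *\<^sub>R ?e)) has_integral I) (square (sh s) r)" for s
  proof -
    have ends: "sh s - vec r = x - vec r + s *\<^sub>R ?e" "sh s + vec r = x + vec r + s *\<^sub>R ?e"
      by (simp_all add: sh_def)
    show ?thesis
      unfolding square_def ends
      using has_integral_affinity'[OF I_has[unfolded sq0], of 1 "- s *\<^sub>R ?e"] by simp
  qed
  have I_nonneg: "0 \<le> I" by (rule has_integral_nonneg[OF I_has \<eta>_nonneg])
  have I_pos: "0 < I"
  proof (rule ccontr)
    assume "\<not> 0 < I"
    then have "(\<eta> has_integral 0) (cbox (x - vec r) (x + vec r))" using I_has I_nonneg by (simp add: sq0)
    moreover have x_box: "x \<in> cbox (x - vec r) (x + vec r)" using r(1) by (simp add: mem_box_cart)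
    moreover have "box (x - vec r) (x + vec r) \<noteq> {}"
    proof -
      have "x \<in> box (x - vec r) (x + vec r)" using r(1) by (simp add: mem_box_cart)
      then show ?thesis by blast
    qed
    ultimately have "\<eta> x = 0"
      by (intro has_integral_0_cbox_imp_0[OF \<eta>_cont]) (auto simp: \<eta>_nonneg)
    moreover have "0 < \<eta> x" using r(1) by (simp add: \<eta>_def bump_pos)
    ultimately show False by simp
  qed
  have on_S: "(\<psi> has_integral t * I) S"
  proof (rule has_integral_on_superset[OF _ \<psi>_out KS])
    have "integral K \<psi> = integral K (\<lambda>z. integral (cbox 0 t) (\<lambda>s. \<eta> (z - s *\<^sub>R ?e)))"
      by (rule integral_cong) (simp add: \<psi>_eq)
    also have "\<dots> = integral (cbox 0 t) (\<lambda>s. integral K (\<lambda>z. \<eta> (z - s *\<^sub>R ?e)))"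
      unfolding K_def by (rule integral_swap_continuous)
        (auto simp: split_beta intro!: continuous_on_compose2[OF \<eta>_cont[of UNIV]] continuous_intros)
    also have "\<dots> = integral (cbox 0 t) (\<lambda>s. I)"
      by (intro integral_cong integral_unique has_integral_on_superset[OF I_shift \<eta>_out] sqK) auto
    also have "\<dots> = t * I" using t by simp
    finally have "integral K \<psi> = t * I" .
    moreover have "\<psi> integrable_on K" unfolding K_def by (intro integrable_continuous \<psi>_cont)
    ultimately show "(\<psi> has_integral t * I) K" by (metis integrable_integral)
  qed
  have Ss: "S \<in> sets lebesgue" using S by simp
  have int_\<psi>: "integrable (lebesgue_on S) \<psi>"
    using integrable_times_compactly_supported[OF S continuous_on_imp_loc_integrable[OF continuous_on_const[of S 1]] \<psi>_cont K KS \<psi>_out]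
    by simp
  have LINT_\<psi>: "(LINT z|lebesgue_on S. \<psi> z) = t * I"
    using lebesgue_integral_eq_integral[OF int_\<psi> Ss] integral_unique[OF on_S] by simp
  have int_g: "integrable (lebesgue_on S) (\<lambda>z. g z * \<psi> z)"
    using f(2) by (intro integrable_times_compactly_supported[OF S _ \<psi>_cont K KS \<psi>_out]) (auto simp: has_weak_partial_def)
  have "\<bar>LINT z|lebesgue_on S. g z * \<psi> z\<bar> \<le> (LINT z|lebesgue_on S. \<bar>g z * \<psi> z\<bar>)"
    by (rule integral_abs_bound)
  also have "\<dots> \<le> (LINT z|lebesgue_on S. C * \<psi> z)"
  proof (rule integral_mono_AE)
    show "integrable (lebesgue_on S) (\<lambda>z. \<bar>g z * \<psi> z\<bar>)" using int_g by simp
    show "integrable (lebesgue_on S) (\<lambda>z. C * \<psi> z)" using int_\<psi> by simp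
    show "AE z in lebesgue_on S. \<bar>g z * \<psi> z\<bar> \<le> C * \<psi> z"
      using g by eventually_elim (simp add: abs_mult \<psi>_nonneg mult_right_mono)
  qed
  also have "\<dots> = C * (t * I)" by (simp add: LINT_\<psi>)
  finally have bound: "\<bar>LINT z|lebesgue_on S. f z * partial k \<psi> z\<bar> \<le> C * (t * I)"
    using f(2) test by (simp add: has_weak_partial_def)
  define J where "J s = integral (square (sh s) r) (\<lambda>z. f z * \<eta> (z - s *\<^sub>R ?e))" for s
  have cont_fs: "continuous_on (square (sh s) r) (\<lambda>z. f z * \<eta> (z - s *\<^sub>R ?e))" if "s \<in> {0..t}" for s
    using sqK[OF that] KS
    by (intro continuous_intros continuous_on_subset[OF f(1)] continuous_on_compose2[OF \<eta>_cont[of UNIV]]) auto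
  have J_sq: "((\<lambda>z. f z * \<eta> (z - s *\<^sub>R ?e)) has_integral J s) (square (sh s) r)" if "s \<in> {0..t}" for s
    unfolding J_def using cont_fs[OF that]
    by (intro integrable_integral) (simp add: square_def integrable_continuous)
  have J_S: "((\<lambda>z. f z * \<eta> (z - s *\<^sub>R ?e)) has_integral J s) S" if "s \<in> {0..t}" for s
    by (rule has_integral_on_superset[OF J_sq[OF that]]) (use \<eta>_out sqK[OF that] KS in auto)
  have "((\<lambda>z. f z * \<eta> (z - 0 *\<^sub>R ?e) - f z * \<eta> (z - t *\<^sub>R ?e)) has_integral J 0 - J t) S"
    using t by (intro has_integral_diff J_S) auto
  then have "((\<lambda>z. f z * partial k \<psi> z) has_integral J 0 - J t) S"
    by (simp add: \<psi>_partial right_diff_distrib)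
  moreover have "integrable (lebesgue_on S) (\<lambda>z. f z * partial k \<psi> z)"
  proof (rule integrable_times_compactly_supported[OF S continuous_on_imp_loc_integrable[OF f(1)] _ K KS])
    show "continuous_on S (partial k \<psi>)" using C1_on_subset[OF \<psi>_C1, of S] by (simp add: C1_on_def)
    show "partial k \<psi> z = 0" if "z \<notin> K" for z
      by (rule partial_zero_outside[OF compact_imp_closed[OF K] \<psi>_out that])
  qed
  ultimately have "(LINT z|lebesgue_on S. f z * partial k \<psi> z) = J 0 - J t"
    using lebesgue_integral_eq_integral[OF _ Ss] by (metis integral_unique)
  with bound have JJ: "\<bar>J 0 - J t\<bar> \<le> C * (t * I)" by simp
  have J_near: "\<bar>J s - f (sh s) * I\<bar> \<le> e / 2 * I"
    if s: "s \<in> {0..t}" and cl: "\<And>z. z \<in> square (sh s) r \<Longrightarrow> \<bar>f z - f (sh s)\<bar> \<le> e / 2" for s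
  proof -
    have D: "((\<lambda>z. f z * \<eta> (z - s *\<^sub>R ?e) - f (sh s) * \<eta> (z - s *\<^sub>R ?e)) has_integral J s - f (sh s) * I) (square (sh s) r)"
      by (intro has_integral_diff has_integral_mult_right J_sq I_shift s)
    have bd: "\<bar>f z * \<eta> (z - s *\<^sub>R ?e) - f (sh s) * \<eta> (z - s *\<^sub>R ?e)\<bar> \<le> e / 2 * \<eta> (z - s *\<^sub>R ?e)"
      if "z \<in> square (sh s) r" for z
    proof -
      have "\<bar>f z - f (sh s)\<bar> * \<eta> (z - s *\<^sub>R ?e) \<le> e / 2 * \<eta> (z - s *\<^sub>R ?e)"
        by (intro mult_right_mono cl that \<eta>_nonneg)
      then show ?thesis by (simp add: abs_mult \<eta>_nonneg flip: left_diff_distrib)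
    qed
    have up: "((\<lambda>z. e / 2 * \<eta> (z - s *\<^sub>R ?e)) has_integral e / 2 * I) (square (sh s) r)"
      by (intro has_integral_mult_right I_shift)
    have "J s - f (sh s) * I \<le> e / 2 * I"
      by (rule has_integral_le[OF D up]) (rule abs_le_D1[OF bd])
    moreover have "- (e / 2 * I) \<le> J s - f (sh s) * I"
    proof (rule has_integral_le[OF has_integral_neg[OF up] D])
      fix z assume "z \<in> square (sh s) r"
      from abs_le_D2[OF bd[OF this]]
      show "- (e / 2 * \<eta> (z - s *\<^sub>R ?e)) \<le> f z * \<eta> (z - s *\<^sub>R ?e) - f (sh s) * \<eta> (z - s *\<^sub>R ?e)"
        by linarith
    qed
    ultimately show ?thesis by linarith
  qed
  have ends: "sh 0 = x" "sh t = ?y" by (simp_all add: sh_def)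
  have "\<bar>J 0 - f x * I\<bar> \<le> e / 2 * I"
    unfolding ends(1)[symmetric]
  proof (rule J_near)
    show "\<bar>f z - f (sh 0)\<bar> \<le> e / 2" if "z \<in> square (sh 0) r" for z
      using that d1(2) sq_cball[of x] r(3) unfolding ends by force
  qed (use t in simp)
  moreover have "\<bar>J t - f ?y * I\<bar> \<le> e / 2 * I"
    unfolding ends(2)[symmetric]
  proof (rule J_near)
    show "\<bar>f z - f (sh t)\<bar> \<le> e / 2" if "z \<in> square (sh t) r" for z
      using that d2(2) sq_cball[of ?y] r(4) unfolding ends by force
  qed (use t in simp)
  ultimately have "\<bar>f ?y * I - f x * I\<bar> \<le> C * (t * I) + e * I"
    using JJ by linarith
  then have "\<bar>f ?y - f x\<bar> * I \<le> (C * t + e) * I"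
  proof -
    have "\<bar>f ?y - f x\<bar> * I = \<bar>f ?y * I - f x * I\<bar>"
      using I_pos by (simp add: abs_mult flip: left_diff_distrib)
    with \<open>\<bar>f ?y * I - f x * I\<bar> \<le> C * (t * I) + e * I\<close> show ?thesis by (simp add: distrib_right)
  qed
  then show "\<bar>f ?y - f x\<bar> \<le> C * t + e" using I_pos by simp
qed

text \<open>Two points of a square are joined inside it by a horizontal and a vertical segment.\<close>

lemma weak_grad_le_imp_Lipschitz_on_square:
  assumes S: "open S" and f: "continuous_on S f" "weak_grad_le S f C"
    and Q: "square y r \<subseteq> S" and x: "x \<in> square y r" and z: "z \<in> square y r"
  shows "\<bar>f x - f z\<bar> \<le> C * (\<Sum>k\<in>UNIV. \<bar>x $ k - z $ k\<bar>)"
proof -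
  obtain G where G: "has_weak_grad S f G" "AE x in lebesgue_on S. norm (G x) \<le> C"
    using f(2) by (auto simp: weak_grad_le_def)
  have Gk: "AE x in lebesgue_on S. \<bar>G x $ k\<bar> \<le> C" for k
    using G(2) by eventually_elim (meson component_le_norm_cart order_trans)
  have up: "\<bar>f (p + t *\<^sub>R axis k 1) - f p\<bar> \<le> C * t"
    if "0 \<le> t" "p \<in> square y r" "p + t *\<^sub>R axis k 1 \<in> square y r" for p t k
  proof (rule weak_partial_bound_imp_Lipschitz_along_axis[OF S f(1) _ Gk that(1)])
    show "has_weak_partial S k f (\<lambda>x. G x $ k)" using G(1) by (simp add: has_weak_grad_def)
    fix s assume s: "s \<in> {0..t}"
    have "\<bar>(p + s *\<^sub>R axis k 1) $ i - y $ i\<bar> \<le> r" for i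
      using that(2,3) s unfolding mem_square_iff by (cases "i = k") (force simp: axis_def dest!: spec[of _ i])+
    then show "p + s *\<^sub>R axis k 1 \<in> S" using Q by (auto simp: mem_square_iff)
  qed
  have step: "\<bar>f (p + t *\<^sub>R axis k 1) - f p\<bar> \<le> C * \<bar>t\<bar>"
    if "p \<in> square y r" "p + t *\<^sub>R axis k 1 \<in> square y r" for p t k
  proof (cases "0 \<le> t")
    case True then show ?thesis using up[OF True that] by simp
  next
    case False
    have "\<bar>f ((p + t *\<^sub>R axis k 1) + (- t) *\<^sub>R axis k 1) - f (p + t *\<^sub>R axis k 1)\<bar> \<le> C * (- t)"
      by (rule up) (use False that in auto)
    then show ?thesis using False by (simp add: abs_minus_commute)
  qed
  define w where "w = z + (x $ 1 - z $ 1) *\<^sub>R axis 1 1"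
  have w: "w $ 1 = x $ 1" "w $ 2 = z $ 2" by (simp_all add: w_def axis_def)
  have wQ: "w \<in> square y r" using x z by (simp add: mem_square_iff forall_2 w)
  have xw: "x = w + (x $ 2 - z $ 2) *\<^sub>R axis 2 1" by (simp add: vec_eq_iff forall_2 w) (simp add: axis_def)
  have "\<bar>f w - f z\<bar> \<le> C * \<bar>x $ 1 - z $ 1\<bar>" using step[OF z] wQ by (simp add: w_def)
  moreover have "\<bar>f x - f w\<bar> \<le> C * \<bar>x $ 2 - z $ 2\<bar>" using step[OF wQ, of "x $ 2 - z $ 2" 2] x xw by simp
  ultimately have "\<bar>f x - f z\<bar> \<le> C * \<bar>x $ 1 - z $ 1\<bar> + C * \<bar>x $ 2 - z $ 2\<bar>" by linarith
  then show ?thesis by (simp add: sum_2 distrib_left)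
qed

section \<open>The gradient estimate\<close>

theorem theorem1p1:
  fixes \<Omega> :: "(real^2) set" and A b :: "real^2 \<Rightarrow> real^2^2" and C1 C2 C3 C4 C5 :: real
  assumes "open \<Omega>" "connected \<Omega>"
    and "C1 > 0" "C2 > 0" "C3 > 0" "C4 > 0" "C5 > 0"
    and "\<And>i j. W1inf \<Omega> (\<lambda>x. A x $ i $ j)"
    and "\<And>i j x. x \<in> \<Omega> \<Longrightarrow> \<bar>A x $ i $ j\<bar> \<le> C1"
    and "\<And>i j. weak_grad_le \<Omega> (\<lambda>x. A x $ i $ j) C1"
    and "\<And>x. x \<in> \<Omega> \<Longrightarrow> det (A x) \<noteq> 0 \<and> inverse \<bar>det (A x)\<bar> \<le> C2"
    and "\<And>x. x \<in> \<Omega> \<Longrightarrow> A x $ 1 $ 1 \<noteq> 0"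
    and "\<And>x. x \<in> \<Omega> \<Longrightarrow> A x $ 2 $ 2 \<noteq> 0"
    and "\<And>i j. W1inf \<Omega> (\<lambda>x. b x $ i $ j)"
    and "\<And>i j x. x \<in> \<Omega> \<Longrightarrow> \<bar>b x $ i $ j\<bar> \<le> C3"
    and "\<And>i j. weak_grad_le \<Omega> (\<lambda>x. b x $ i $ j) C3"
  shows "\<exists>Cbar :: real \<Rightarrow> real \<Rightarrow> real.
     (\<forall>m>0. \<forall>\<delta>>0. 0 < Cbar m \<delta>) \<and>
     (\<forall>m>0. Cbar m \<in> O[at_right 0](\<lambda>\<delta>. 1 / \<delta>)) \<and>
     (\<forall>\<delta>>0. antimono_on {0<..} (\<lambda>m. Cbar m \<delta>)) \<and>
     (\<forall>u y \<delta>. C2_on \<Omega> u \<and> diff_ineqs \<Omega> A b C4 u \<and> (\<forall>x\<in>\<Omega>. \<bar>u x\<bar> \<le> C5) \<and>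
        y \<in> \<Omega> \<and> \<delta> > 0 \<and> square y (2 * \<delta>) \<subseteq> \<Omega> \<longrightarrow>
        (\<forall>x \<in> square y \<delta>. norm (grad u x) \<le> Cbar (diag_inf A (square y (2 * \<delta>))) \<delta>))"
proof (intro exI[of _ "gradient_constant C1 C2 C3 C4 C5"] conjI allI impI ballI)
  note pos = assms(3-7)
  show "0 < gradient_constant C1 C2 C3 C4 C5 m \<delta>" if "m > 0" "\<delta> > 0" for m \<delta>
    using gradient_constant_pos[OF pos that] .
  show "gradient_constant C1 C2 C3 C4 C5 m \<in> O[at_right 0](\<lambda>\<delta>. 1 / \<delta>)" for m
    by (rule gradient_constant_bigo)
  show "antimono_on {0<..} (\<lambda>m. gradient_constant C1 C2 C3 C4 C5 m \<delta>)" if "\<delta> > 0" for \<delta>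
    by (rule gradient_constant_antimono[OF pos(1-3) pos(5) that])
  fix u y \<delta> x
  assume *: "C2_on \<Omega> u \<and> diff_ineqs \<Omega> A b C4 u \<and> (\<forall>x\<in>\<Omega>. \<bar>u x\<bar> \<le> C5) \<and>
      y \<in> \<Omega> \<and> \<delta> > 0 \<and> square y (2 * \<delta>) \<subseteq> \<Omega>"
    and x: "x \<in> square y \<delta>"
  let ?Q = "square y (2 * \<delta>)"
  define m where "m = diag_inf A ?Q"
  have \<delta>: "\<delta> > 0" and Q: "?Q \<subseteq> \<Omega>" and u: "C2_on \<Omega> u" using * by auto
  note inO = subsetD[OF Q]
  have A_cont: "continuous_on \<Omega> (\<lambda>x. A x $ i $ j)" for i j
    using assms(8) by (simp add: W1inf_def)
  have b_cont: "continuous_on \<Omega> (\<lambda>x. b x $ i $ j)" for i j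
    using assms(14) by (simp add: W1inf_def)
  have m: "0 < m"
    unfolding m_def
  proof (rule diag_inf_pos)
    show "compact ?Q" by (simp add: square_def)
    have "y \<in> ?Q" using \<delta> by (simp add: mem_square_iff)
    then show "?Q \<noteq> {}" by blast
    show "continuous_on ?Q (\<lambda>x. A x $ i $ j)" for i j
      by (rule continuous_on_subset[OF A_cont Q])
  qed (use assms(12,13) inO in auto)
  have A_diag: "m \<le> \<bar>A x $ i $ i\<bar>" if "x \<in> ?Q" for i x
  proof -
    have "m \<le> min \<bar>A x $ 1 $ 1\<bar> \<bar>A x $ 2 $ 2\<bar>"
      unfolding m_def diag_inf_def using that by (intro cINF_lower bdd_belowI2[of _ 0]) auto
    then show ?thesis using exhaust_2[of i] by auto
  qed
  from * obtain h where h: "\<And>i j. has_weak_partial \<Omega> i (\<lambda>x. A x $ i $ j * partial j u x) (h i j)"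
      "\<And>i. AE x in lebesgue_on \<Omega>. - (\<Sum>j\<in>UNIV. h i j x + b x $ i $ j * partial j u x) \<le> C4"
    unfolding diff_ineqs_def by blast
  show "norm (grad u x) \<le> gradient_constant C1 C2 C3 C4 C5 (diag_inf A ?Q) \<delta>"
    unfolding m_def[symmetric]
  proof (rule interior_gradient_estimate[OF assms(1) u Q \<delta> pos m])
    show "continuous_on ?Q (\<lambda>x. A x $ i $ j)" for i j
      by (rule continuous_on_subset[OF A_cont Q])
    show "\<bar>A x $ i $ j\<bar> \<le> C1" if "x \<in> ?Q" for i j x
      by (rule assms(9)[OF inO[OF that]])
    show "\<bar>A x $ i $ j - A z $ i $ j\<bar> \<le> C1 * (\<Sum>k\<in>UNIV. \<bar>x $ k - z $ k\<bar>)"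
      if "x \<in> ?Q" "z \<in> ?Q" for i j x z
      by (rule weak_grad_le_imp_Lipschitz_on_square[OF assms(1) A_cont assms(10) Q that])
    show "m \<le> \<bar>A x $ i $ i\<bar>" if "x \<in> ?Q" for i x by (rule A_diag[OF that])
    show "det (A x) \<noteq> 0 \<and> inverse \<bar>det (A x)\<bar> \<le> C2" if "x \<in> ?Q" for x
      by (rule assms(11)[OF inO[OF that]])
    show "\<bar>u x\<bar> \<le> C5" if "x \<in> ?Q" for x using * inO[OF that] by blast
    show "- (C4 + (C1 + C3) * (\<Sum>k\<in>UNIV. \<bar>partial k u x\<bar>))
        \<le> (\<Sum>j\<in>UNIV. A x $ i $ j * partial i (partial j u) x)" if "x \<in> ?Q" for i x
      by (rule pointwise_differential_inequality[OF assms(1) u _ _ A_cont assms(10) b_cont assms(15) h inO[OF that]])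
        (use pos in auto)
    show "x \<in> square y \<delta>" by (rule x)
  qed
qed

end
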